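(* Let $\nu>-1/2$ and let $P_n(x)=\sum_{k=0}^na_{n,k}x^k$, $a_{n,n}>0$, $n\in\mathbb{N}_0$, be the polynomials orthonormal with respect to $\rho_\nu^2$ on $(0,\infty)$: $\int_0^\infty P_m(x)P_n(x)\rho_\nu^2(x)\,dx=\delta_{n,m}$. With $D_n$, $D_{n,k}$ the determinants defined in the context, the coefficients of $P_n$ are given explicitly by $$a_{n,k}=-a_{n,0}\,\frac{D_{n,k}}{D_n},\qquad k=1,\dots,n,$$ $$a_{n,0}=\pm\,D_n\left[D_{n,n}\,S_n\right]^{-1/2},\qquad S_n=\sqrt\pi\,\frac{\Gamma(1+2\nu)\Gamma(1+\nu)}{2^{1+2\nu}\Gamma(\nu+3/2)}\sum_{k=0}^nD_{n,k}\,(n+k)!\,\frac{(1+2\nu)_{n+k}(1+\nu)_{n+k}}{4^{n+k}(\nu+3/2)_{n+k}},$$ where the sign is chosen so that $a_{n,n}>0$. Moreover, $\{P_n\}_{n\ge0}$ satisfies the three-term recurrence relation $$xP_n(x)=A_{n+1}P_{n+1}(x)+B_nP_n(x)+A_nP_{n-1}(x),\qquad P_{-1}\equiv0,$$ where $$A_{n+1}=\frac{a_{n,0}\,D_{n+1}\,D_{n,n}}{a_{n+1,0}\,D_n\,D_{n+1,n+1}},\qquad B_n=\frac{D_{n,n-1}}{D_{n,n}}-\frac{D_{n+1,n}}{D_{n+1,n+1}} .$$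
   Context: For $x>0$, $\rho_\nu(x)=2x^{\nu/2}K_\nu(2\sqrt x)$, with $K_\nu$ the Macdonald function (modified Bessel function of the second kind). $(a)_k$ is the Pochhammer symbol, $L_r^\nu$ the generalized Laguerre polynomials, $\Gamma(a,z)=\int_z^\infty e^{-u}u^{a-1}du$ the incomplete gamma function, and $\theta\{f\}(t)=t\frac{d}{dt}(tf(t))$. For integers $k,m,r\ge0$ put $$c_{k,r}=\frac{r!}{\Gamma(1+\nu+r)}\int_0^\infty t^\nu e^{-t}L_r^\nu(t)\,\theta^k\left(t^\nu e^t\Gamma(-\nu,t)\right)dt,\qquad d_{m,r}=\int_0^\infty t^{\nu+m}e^{-t}L_m^\nu(t)L_r^\nu(t)\,dt,$$ $$f_{k,m}=\sum_{r=0}^{2m}c_{k,r}\,d_{m,r}.$$ For $n\ge1$, $D_n$ is the determinant of the $n\times n$ matrix whose row $m$ ($m=0,\dots,n-1$) is $(f_{1,m},f_{2,m},\dots,f_{n,m})$. For $1\le k\le n$, $D_{n,k}$ is the determinant obtained from $D_n$ by replacing its $k$-th column $(f_{k,m})_{m=0}^{n-1}$ by the column $(f_{0,m})_{m=0}^{n-1}$. Also $D_{n,0}=-D_n$. For $n=0$ use the conventions $D_0=1$, $D_{0,0}=-1$, $D_{0,-1}=0$. *)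

theory Defs
  imports "HOL-Analysis.Analysis" "Jordan_Normal_Form.Determinant"
begin

text \<open>
  The Macdonald function (modified Bessel function of the second kind) at a positive real argument,
  given by its classical integral representation
  \<open>K\<^sub>\<nu>(x) = \<integral>\<^sub>0\<^sup>\<infinity> exp (- x cosh u) cosh (\<nu> u) du\<close>.
\<close>

definition macdonald_K :: "real \<Rightarrow> real \<Rightarrow> real" where
  "macdonald_K \<nu> x = (LBINT u:{0<..}. exp (- x * cosh u) * cosh (\<nu> * u))"

definition rho :: "real \<Rightarrow> real \<Rightarrow> real" where
  "rho \<nu> x = 2 * x powr (\<nu> / 2) * macdonald_K \<nu> (2 * sqrt x)"

definition laguerre :: "nat \<Rightarrow> real \<Rightarrow> real \<Rightarrow> real" where
  "laguerre r \<nu> t = (\<Sum>i\<le>r. (- 1) ^ i * ((\<nu> + real r) gchoose (r - i)) * t ^ i / fact i)"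

definition inc_Gamma :: "real \<Rightarrow> real \<Rightarrow> real" where
  "inc_Gamma a z = (LBINT u:{z<..}. exp (- u) * u powr (a - 1))"

definition theta :: "(real \<Rightarrow> real) \<Rightarrow> real \<Rightarrow> real" where
  "theta f = (\<lambda>t. t * deriv (\<lambda>s. s * f s) t)"

definition c_coef :: "real \<Rightarrow> nat \<Rightarrow> nat \<Rightarrow> real" where
  "c_coef \<nu> k r = fact r / Gamma (1 + \<nu> + real r) *
     (LBINT t:{0<..}. t powr \<nu> * exp (- t) * laguerre r \<nu> t *
        (theta ^^ k) (\<lambda>s. s powr \<nu> * exp s * inc_Gamma (- \<nu>) s) t)"

definition d_coef :: "real \<Rightarrow> nat \<Rightarrow> nat \<Rightarrow> real" where
  "d_coef \<nu> m r =
     (LBINT t:{0<..}. t powr (\<nu> + real m) * exp (- t) * laguerre m \<nu> t * laguerre r \<nu> t)"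

definition f_coef :: "real \<Rightarrow> nat \<Rightarrow> nat \<Rightarrow> real" where
  "f_coef \<nu> k m = (\<Sum>r\<le>2 * m. c_coef \<nu> k r * d_coef \<nu> m r)"

text \<open>Matrix indices start at 0, so column \<open>j\<close> holds the values \<open>f_coef \<nu> (j + 1) m\<close>.\<close>

definition f_mat :: "real \<Rightarrow> nat \<Rightarrow> real mat" where
  "f_mat \<nu> n = Matrix.mat n n (\<lambda>(m, j). f_coef \<nu> (j + 1) m)"

text \<open>The value for \<open>n = 0\<close> is 1, the determinant of the empty matrix.\<close>

definition D :: "real \<Rightarrow> nat \<Rightarrow> real" where
  "D \<nu> n = Determinant.det (f_mat \<nu> n)"

text \<open>
  The second index is an integer because \<open>Dcol \<nu> 0 (- 1)\<close> occurs in the recurrence, with the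
  conventional value 0. Also \<open>Dcol \<nu> 0 0 = - D \<nu> 0 = - 1\<close>. Indices below \<open>- 1\<close> or above \<open>n\<close> are
  not used, nor is \<open>- 1\<close> for \<open>n \<ge> 1\<close>.
\<close>

definition Dcol :: "real \<Rightarrow> nat \<Rightarrow> int \<Rightarrow> real" where
  "Dcol \<nu> n k =
     (if k = 0 then - D \<nu> n
      else if 1 \<le> k \<and> k \<le> int n
        then Determinant.det
               (replace_col (f_mat \<nu> n) (Matrix.vec n (\<lambda>m. f_coef \<nu> 0 m)) (nat k - 1))
      else 0)"

definition S :: "real \<Rightarrow> nat \<Rightarrow> real" where
  "S \<nu> n =
     sqrt pi * (Gamma (1 + 2 * \<nu>) * Gamma (1 + \<nu>)) / (2 powr (1 + 2 * \<nu>) * Gamma (\<nu> + 3 / 2)) *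
     (\<Sum>k\<le>n. Dcol \<nu> n (int k) * fact (n + k) *
        (pochhammer (1 + 2 * \<nu>) (n + k) * pochhammer (1 + \<nu>) (n + k) /
         (4 ^ (n + k) * pochhammer (\<nu> + 3 / 2) (n + k))))"

definition orthonormal_polys :: "(real \<Rightarrow> real) \<Rightarrow> (nat \<Rightarrow> real poly) \<Rightarrow> bool" where
  "orthonormal_polys w P \<longleftrightarrow>
     (\<forall>n. degree (P n) = n \<and> coeff (P n) n > 0) \<and>
     (\<forall>m n. (LBINT x:{0<..}. poly (P m) x * poly (P n) x * w x) = (if m = n then 1 else 0))"

end

theory Submission
  imports Defs
begin

text \<open>
  From \<open>\<rho>\<^sub>\<nu>(x) = \<integral> t\<^sup>\<nu>\<^sup>-\<^sup>1 exp (- t - x / t) dt\<close> one gets, by Tonelli and Beta integrals, the closed form of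
  \<open>\<integral> x\<^sup>k \<rho>\<^sub>\<nu> \<rho>\<^sub>\<nu>\<^sub>+\<^sub>p\<close>. The Laplace transform of \<open>x\<^sup>k \<rho>\<^sub>\<nu>\<close> at \<open>1 / t\<close> is
  \<open>\<Gamma>(1 + \<nu>) t \<theta>\<^sup>k{t\<^sup>\<nu> e\<^sup>t \<Gamma>(-\<nu>, t)}\<close>, because each application of \<open>\<theta>\<close> is one differentiation of
  the transform. Since \<open>t\<^sup>m L\<^sub>m\<close> is a combination of \<open>L\<^sub>r\<close> with \<open>r \<le> 2m\<close>, the finite sum defining
  \<open>f\<^sub>k\<^sub>,\<^sub>m\<close> is the integral of \<open>t\<^sup>\<nu>\<^sup>+\<^sup>m e\<^sup>-\<^sup>t L\<^sub>m(t)\<close> against \<open>\<theta>\<^sup>k{\<dots>}\<close>, and this collapses to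
  \<open>(-1)\<^sup>m / (m! \<Gamma>(1 + \<nu>))\<close> times the moment of order \<open>k + m\<close> of \<open>\<rho>\<^sub>\<nu>\<^sup>2\<close>. So \<open>D\<^sub>n\<close> is, up to row
  factors, the Hankel determinant of the weight \<open>x \<rho>\<^sub>\<nu>\<^sup>2\<close>, and the formulas for the coefficients
  are Cramer's rule for the orthogonality conditions.
\<close>

section \<open>Integration over the positive half-line\<close>

text \<open>A measure of its own rather than set integrals over \<open>lborel\<close>: iterated
  nonnegative integrals, substitutions and Bochner integrals can then be written without indicators,
  and pointwise side conditions come with \<open>0 < x\<close>.\<close>

definition lpos :: "real measure" where
  "lpos = restrict_space lborel {0<..}"

lemma space_lpos [simp]: "space lpos = {0<..}"
  by (simp add: lpos_def space_restrict_space)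

lemma measurable_lpos:
  "f \<in> measurable borel N \<Longrightarrow> f \<in> measurable lpos N"
  unfolding lpos_def by (rule measurable_restrict_space1) simp

lemma nn_integral_lpos: "(\<integral>\<^sup>+x. f x \<partial>lpos) = (\<integral>\<^sup>+x. f x * indicator {0<..} x \<partial>lborel)"
  unfolding lpos_def by (rule nn_integral_restrict_space) simp

lemma set_lebesgue_integral_lpos:
  fixes f :: "real \<Rightarrow> real"
  shows "(LBINT x:{0<..}. f x) = (\<integral>x. f x \<partial>lpos)"
  unfolding lpos_def set_lebesgue_integral_def by (rule integral_restrict_space[symmetric]) simp

lemma nn_integral_lpos_cong:
  "(\<And>x. 0 < x \<Longrightarrow> f x = g x) \<Longrightarrow> (\<integral>\<^sup>+x. f x \<partial>lpos) = (\<integral>\<^sup>+x. g x \<partial>lpos)"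
  by (rule nn_integral_cong) simp

lemma borel_measurable_nn_integral_lpos [measurable (raw)]:
  assumes [measurable]: "case_prod f \<in> borel_measurable (N \<Otimes>\<^sub>M borel)"
  shows "(\<lambda>x. \<integral>\<^sup>+y. f x y \<partial>lpos) \<in> borel_measurable N"
  unfolding nn_integral_lpos by measurable

text \<open>Only nonnegative integrands are interchanged, so joint measurability suffices;
  integrability is recovered afterwards from the finite values.\<close>

lemma tonelli_lpos:
  assumes [measurable]: "case_prod f \<in> borel_measurable (borel \<Otimes>\<^sub>M borel)"
  shows "(\<integral>\<^sup>+x. \<integral>\<^sup>+y. f x y \<partial>lpos \<partial>lpos) = (\<integral>\<^sup>+y. \<integral>\<^sup>+x. f x y \<partial>lpos \<partial>lpos)"
proof -
  have "(\<integral>\<^sup>+x. \<integral>\<^sup>+y. f x y \<partial>lpos \<partial>lpos)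
      = (\<integral>\<^sup>+x. \<integral>\<^sup>+y. f x y * indicator {0<..} y * indicator {0<..} x \<partial>lborel \<partial>lborel)"
    by (simp add: nn_integral_lpos nn_integral_multc)
  also have "\<dots> = (\<integral>\<^sup>+y. \<integral>\<^sup>+x. f x y * indicator {0<..} y * indicator {0<..} x \<partial>lborel \<partial>lborel)"
    by (rule lborel_pair.Fubini') measurable
  also have "\<dots> = (\<integral>\<^sup>+y. \<integral>\<^sup>+x. f x y * indicator {0<..} x * indicator {0<..} y \<partial>lborel \<partial>lborel)"
    by (simp add: mult_ac)
  also have "\<dots> = (\<integral>\<^sup>+y. \<integral>\<^sup>+x. f x y \<partial>lpos \<partial>lpos)"
    by (simp add: nn_integral_lpos nn_integral_multc)
  finally show ?thesis .
qed

lemma nn_integral_lpos_scale: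
  assumes [measurable]: "f \<in> borel_measurable borel" and c: "0 < c"
  shows "(\<integral>\<^sup>+x. f x \<partial>lpos) = ennreal c * (\<integral>\<^sup>+x. f (c * x) \<partial>lpos)"
proof -
  have "(\<integral>\<^sup>+x. f x \<partial>lpos) = ennreal \<bar>c\<bar> * (\<integral>\<^sup>+x. f (0 + c * x) * indicator {0<..} (0 + c * x) \<partial>lborel)"
    unfolding nn_integral_lpos using c by (intro nn_integral_real_affine) auto
  also have "\<dots> = ennreal c * (\<integral>\<^sup>+x. f (c * x) \<partial>lpos)"
    unfolding nn_integral_lpos using c
    by (auto intro!: arg_cong[where f="\<lambda>z. ennreal c * z"] nn_integral_cong
        simp: indicator_def zero_less_mult_iff)
  finally show ?thesis .
qed

lemma nn_integral_lpos_shift: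
  assumes [measurable]: "f \<in> borel_measurable borel" and "0 \<le> c"
  shows "(\<integral>\<^sup>+x. f x * indicator {c<..} x \<partial>lpos) = (\<integral>\<^sup>+x. f (c + x) \<partial>lpos)"
proof -
  have "(\<integral>\<^sup>+x. f x * indicator {c<..} x \<partial>lpos)
      = (\<integral>\<^sup>+x. f x * indicator {c<..} x \<partial>lborel)"
    unfolding nn_integral_lpos using assms(2)
    by (intro nn_integral_cong) (auto simp: indicator_def)
  also have "\<dots> = ennreal \<bar>1\<bar> * (\<integral>\<^sup>+x. f (c + 1 * x) * indicator {c<..} (c + 1 * x) \<partial>lborel)"
    by (intro nn_integral_real_affine) auto
  also have "\<dots> = (\<integral>\<^sup>+x. f (c + x) \<partial>lpos)"
    unfolding nn_integral_lpos by (auto intro!: nn_integral_cong simp: indicator_def)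
  finally show ?thesis .
qed

lemma nn_integral_lpos_cmult:
  "f \<in> borel_measurable borel \<Longrightarrow> 0 \<le> c \<Longrightarrow> (\<And>x. 0 < x \<Longrightarrow> 0 \<le> f x) \<Longrightarrow>
   (\<integral>\<^sup>+x. ennreal (c * f x) \<partial>lpos) = ennreal c * (\<integral>\<^sup>+x. ennreal (f x) \<partial>lpos)"
  by (subst nn_integral_cmult[symmetric]) (auto intro!: nn_integral_lpos_cong measurable_lpos simp: ennreal_mult)

text \<open>Substituting \<open>c * t\<close> in Euler's integral produces the factor
  \<open>c powr a\<close>, which is then moved to the other side.\<close>

lemma nn_integral_Gamma:
  fixes a c :: real
  assumes a: "0 < a" and c: "0 < c"
  shows "(\<integral>\<^sup>+t. ennreal (t powr (a - 1) * exp (- c * t)) \<partial>lpos) = ennreal (Gamma a * c powr (- a))"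
proof -
  have "ennreal (Gamma a) = (\<integral>\<^sup>+t. ennreal (t powr (a - 1) * exp (- t)) \<partial>lpos)"
    unfolding Gamma_conv_nn_integral_real[OF a] nn_integral_lpos
    by (intro nn_integral_cong) (auto simp: indicator_def exp_minus field_simps)
  also have "\<dots> = ennreal c * (\<integral>\<^sup>+t. ennreal ((c * t) powr (a - 1) * exp (- (c * t))) \<partial>lpos)"
    by (rule nn_integral_lpos_scale[OF _ c]) measurable
  also have "(\<integral>\<^sup>+t. ennreal ((c * t) powr (a - 1) * exp (- (c * t))) \<partial>lpos)
     = (\<integral>\<^sup>+t. ennreal (c powr (a - 1) * (t powr (a - 1) * exp (- c * t))) \<partial>lpos)"
    using c by (intro nn_integral_lpos_cong) (auto simp: powr_mult)
  also have "\<dots> = ennreal (c powr (a - 1)) * (\<integral>\<^sup>+t. ennreal (t powr (a - 1) * exp (- c * t)) \<partial>lpos)"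
    by (rule nn_integral_lpos_cmult) auto
  finally have "ennreal (Gamma a) = ennreal (c powr a) * (\<integral>\<^sup>+t. ennreal (t powr (a - 1) * exp (- c * t)) \<partial>lpos)"
    using c by (simp add: mult.assoc[symmetric] ennreal_mult[symmetric] powr_diff field_simps)
  \<comment> \<open>Division is replaced by multiplication with the reciprocal power, since the
    integral is not yet known to be finite.\<close>
  then have "ennreal (c powr (-a)) * ennreal (Gamma a) = ennreal (c powr (-a)) * ennreal (c powr a) * (\<integral>\<^sup>+t. ennreal (t powr (a - 1) * exp (- c * t)) \<partial>lpos)"
    by (simp add: mult.assoc)
  then show ?thesis using c a
    by (simp add: ennreal_mult[symmetric] powr_add[symmetric] mult.commute Gamma_real_pos less_imp_le)
qed

lemma nn_integral_Gamma_power: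
  assumes c: "0 < (c::real)"
  shows "(\<integral>\<^sup>+t. ennreal (t ^ k * exp (- c * t)) \<partial>lpos) = ennreal (fact k * c powr (- real (Suc k)))"
proof -
  have "(\<integral>\<^sup>+t. ennreal (t ^ k * exp (- c * t)) \<partial>lpos)
      = (\<integral>\<^sup>+t. ennreal (t powr (real (Suc k) - 1) * exp (- c * t)) \<partial>lpos)"
    by (intro nn_integral_lpos_cong) (simp add: powr_realpow)
  also have "\<dots> = ennreal (fact k * c powr (- real (Suc k)))"
    using c Gamma_fact[of k, where 'a=real] by (subst nn_integral_Gamma) auto
  finally show ?thesis .
qed

section \<open>The weight as an integral\<close>

text \<open>The integral representation of the weight with extended values, so that it is Borel on
  the whole line and enters Tonelli directly. It is identified with \<open>rho\<close> for positive
  arguments only.\<close>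

definition rho_nn :: "real \<Rightarrow> real \<Rightarrow> ennreal" where
  "rho_nn \<nu> x = (\<integral>\<^sup>+t. ennreal (t powr (\<nu> - 1) * exp (- t - x / t)) \<partial>lpos)"

lemma rho_nn_measurable [measurable]: "rho_nn \<nu> \<in> borel_measurable borel"
  unfolding rho_nn_def[abs_def] by measurable

text \<open>Near \<open>t = 0\<close> the factor \<open>exp (- x / t)\<close> beats every negative
  power of \<open>t\<close>, and at infinity \<open>exp (- t)\<close> decides; a Gamma integral
  dominates both ends.\<close>

lemma rho_nn_finite:
  assumes x: "0 < x"
  shows "rho_nn \<nu> x < \<infinity>"
proof -
  \<comment> \<open>\<open>N\<close> powers of \<open>t\<close> lift the exponent into the range
    where Euler's integral converges.\<close>
  obtain N :: nat where N: "0 < \<nu> + real N"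
    using reals_Archimedean2[of "- \<nu>"] by (metis add.commute add_0 diff_less_eq diff_minus_eq_add minus_add_cancel)
  have b: "exp (- (x / t)) \<le> fact N / x ^ N * t ^ N" if t: "0 < t" for t
  proof -
    \<comment> \<open>A single term of the exponential series bounds \<open>exp (x / t)\<close> from
      below.\<close>
    have "(\<Sum>n\<in>{N}. (x / t) ^ n /\<^sub>R fact n) \<le> (\<Sum>n. (x / t) ^ n /\<^sub>R fact n)"
      using x t by (intro sum_le_suminf summable_exp_generic) auto
    then have "(x / t) ^ N / fact N \<le> exp (x / t)"
      by (simp add: exp_def field_simps)
    then show ?thesis using x t by (simp add: exp_minus field_simps)
  qed
  have "rho_nn \<nu> x \<le> (\<integral>\<^sup>+t. ennreal (fact N / x ^ N * (t powr (\<nu> + N - 1) * exp (- 1 * t))) \<partial>lpos)"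
    unfolding rho_nn_def
  proof (intro nn_integral_mono ennreal_leI)
    fix t assume "t \<in> space lpos"
    then have t: "0 < t" by simp
    have "t powr (\<nu> - 1) * exp (- t - x / t) = t powr (\<nu> - 1) * exp (- t) * exp (- (x / t))"
      by (simp add: mult_exp_exp)
    also have "\<dots> \<le> t powr (\<nu> - 1) * exp (- t) * (fact N / x ^ N * t ^ N)"
      using b[OF t] by (intro mult_left_mono) auto
    also have "\<dots> = fact N / x ^ N * (t powr (\<nu> + N - 1) * exp (- 1 * t))"
      using t by (simp add: powr_realpow[symmetric] powr_add[symmetric] algebra_simps)
    finally show "t powr (\<nu> - 1) * exp (- t - x / t) \<le> fact N / x ^ N * (t powr (\<nu> + N - 1) * exp (- 1 * t))" .
  qed
  also have "\<dots> = ennreal (fact N / x ^ N) * (\<integral>\<^sup>+t. ennreal (t powr (\<nu> + N - 1) * exp (- 1 * t)) \<partial>lpos)"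
    using x by (intro nn_integral_lpos_cmult) auto
  also have "\<dots> < \<infinity>"
    by (subst nn_integral_Gamma[OF N]) (auto simp: ennreal_mult_less_top)
  finally show ?thesis .
qed

text \<open>The substitution \<open>x = c * exp u\<close> maps the whole line onto the half-line.
  Finiteness is assumed because the change of variables is done for absolutely integrable
  functions.\<close>

lemma nn_integral_lpos_exp:
  fixes f :: "real \<Rightarrow> real"
  assumes [measurable]: "f \<in> borel_measurable borel" and nn: "\<And>x. 0 < x \<Longrightarrow> 0 \<le> f x"
    and fin: "(\<integral>\<^sup>+x. ennreal (f x) \<partial>lpos) < \<infinity>" and c: "0 < c"
  shows "(\<integral>\<^sup>+u. ennreal (c * exp u * f (c * exp u)) \<partial>lborel) = (\<integral>\<^sup>+x. ennreal (f x) \<partial>lpos)"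
proof -
  define b where "b = (LBINT x:{0<..}. f x)"
  have img: "range (\<lambda>u. c * exp u) = {0<..}"
  proof (intro equalityI subsetI)
    fix x :: real assume "x \<in> {0<..}"
    then have "x = c * exp (ln (x / c))" using c by simp
    then show "x \<in> range (\<lambda>u. c * exp u)" by blast
  qed (use c in auto)
  have int: "integrable lpos f"
    using fin nn by (intro integrableI_nonneg) (auto simp: AE_I2 measurable_lpos)
  then have s: "set_integrable lborel {0<..} f"
    unfolding set_integrable_def lpos_def by (subst (asm) integrable_restrict_space) auto
  then have "set_integrable lebesgue {0<..} f"
    unfolding set_integrable_def by (subst integrable_completion) auto
  then have "f absolutely_integrable_on (\<lambda>u. c * exp u) ` UNIV \<and> integral ((\<lambda>u. c * exp u) ` UNIV) f = b"
    using set_borel_integral_eq_integral(2)[OF s] img by (simp add: b_def)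
  then have "(\<lambda>u. \<bar>c * exp u\<bar> * f (c * exp u)) absolutely_integrable_on UNIV
      \<and> integral UNIV (\<lambda>u. \<bar>c * exp u\<bar> * f (c * exp u)) = b"
    using c by (subst has_absolute_integral_change_of_variables_1') (auto intro!: derivative_eq_intros inj_onI)
  then have "((\<lambda>u. c * exp u * f (c * exp u)) has_integral b) UNIV"
    using c set_lebesgue_integral_eq_integral(1) by (auto simp: has_integral_iff)
  from nn_integral_has_integral_lebesgue[OF _ this]
  have "(\<integral>\<^sup>+u. ennreal (c * exp u * f (c * exp u)) \<partial>lborel) = ennreal b"
    using c nn by simp
  also have "ennreal b = (\<integral>\<^sup>+x. ennreal (f x) \<partial>lpos)"
    unfolding b_def set_lebesgue_integral_lpos
    using int nn by (intro nn_integral_eq_integral[symmetric]) (auto simp: AE_I2)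
  finally show ?thesis .
qed

lemma borel_measurable_cosh [measurable (raw)]:
  fixes f :: "'a \<Rightarrow> real"
  assumes "f \<in> borel_measurable M"
  shows "(\<lambda>x. cosh (f x)) \<in> borel_measurable M"
  unfolding cosh_def using assms by measurable

text \<open>With \<open>t = sqrt x * exp u\<close> the exponent \<open>- t - x / t\<close> becomes
  \<open>- 2 * sqrt x * cosh u\<close>. Folding the line at \<open>u = 0\<close> then turns
  \<open>exp (\<nu> * u)\<close> into \<open>2 * cosh (\<nu> * u)\<close>, which is the Macdonald
  integral.\<close>

lemma rho_nn_eq:
  assumes x: "0 < x"
  shows "rho_nn \<nu> x = ennreal (rho \<nu> x)" "0 \<le> rho \<nu> x"
proof -
  let ?f = "\<lambda>t. t powr (\<nu> - 1) * exp (- t - x / t)"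
  let ?G = "\<lambda>u. x powr (\<nu> / 2) * (exp (\<nu> * u) * exp (- (2 * sqrt x) * cosh u))"
  have G: "sqrt x * exp u * ?f (sqrt x * exp u) = ?G u" for u
  proof -
    have "x / (sqrt x * exp u) = sqrt x * exp (- u)"
      using x by (simp add: exp_minus field_simps)
    then have "exp (- (sqrt x * exp u) - x / (sqrt x * exp u)) = exp (- (2 * sqrt x) * cosh u)"
      by (simp add: cosh_def algebra_simps)
    moreover have "sqrt x * exp u * (sqrt x * exp u) powr (\<nu> - 1) = (sqrt x * exp u) powr \<nu>"
      using x by (simp add: powr_diff)
    moreover have "(sqrt x * exp u) powr \<nu> = x powr (\<nu> / 2) * exp (\<nu> * u)"
    proof -
      have "sqrt x powr \<nu> = x powr (\<nu> / 2)"
        using x by (subst powr_half_sqrt[symmetric]) (auto simp: powr_powr)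
      moreover have "exp u powr \<nu> = exp (\<nu> * u)" by (simp add: powr_def)
      ultimately show ?thesis using x by (simp add: powr_mult)
    qed
    moreover have "sqrt x * exp u * ?f (sqrt x * exp u)
        = sqrt x * exp u * (sqrt x * exp u) powr (\<nu> - 1) * exp (- (sqrt x * exp u) - x / (sqrt x * exp u))"
      by (rule mult.assoc[symmetric])
    ultimately show ?thesis
      by (simp only: mult.assoc)
  qed
  have "rho_nn \<nu> x = (\<integral>\<^sup>+u. ennreal (sqrt x * exp u * ?f (sqrt x * exp u)) \<partial>lborel)"
    unfolding rho_nn_def
    by (rule nn_integral_lpos_exp[symmetric]) (use x rho_nn_finite[OF x, of \<nu>] in \<open>auto simp: rho_nn_def\<close>)
  also have "\<dots> = (\<integral>\<^sup>+u. ennreal (?G u) \<partial>lborel)"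
    by (simp only: G)
  also have "\<dots> = (\<integral>\<^sup>+u. ennreal (?G u) * indicator {0<..} u + ennreal (?G u) * indicator {..0} u \<partial>lborel)"
    by (intro nn_integral_cong) (auto simp: indicator_def)
  also have "\<dots> = (\<integral>\<^sup>+u. ennreal (?G u) * indicator {0<..} u \<partial>lborel) + (\<integral>\<^sup>+u. ennreal (?G u) * indicator {..0} u \<partial>lborel)"
    by (intro nn_integral_add) measurable
  also have "(\<integral>\<^sup>+u. ennreal (?G u) * indicator {..0} u \<partial>lborel) = (\<integral>\<^sup>+u. ennreal (?G (- u)) * indicator {0<..} u \<partial>lborel)"
  proof -
    have "(\<integral>\<^sup>+u. ennreal (?G u) * indicator {..0} u \<partial>lborel) = (\<integral>\<^sup>+u. ennreal (?G (- u)) * indicator {..0} (- u) \<partial>lborel)"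
      using nn_integral_real_affine[of "\<lambda>u. ennreal (?G u) * indicator {..0} u" "-1" 0] by simp
    also have "\<dots> = (\<integral>\<^sup>+u. ennreal (?G (- u)) * indicator {0<..} u \<partial>lborel)"
    \<comment> \<open>After reflection the closed and the open half-line differ at \<open>0\<close>
      only, a null set.\<close>
    proof (rule nn_integral_cong_AE)
      show "AE u in lborel. ennreal (?G (- u)) * indicator {..0} (- u) = ennreal (?G (- u)) * indicator {0<..} u"
        using AE_lborel_singleton[of "0::real"]
        by eventually_elim (auto simp: indicator_def)
    qed
    finally show ?thesis .
  qed
  also have "(\<integral>\<^sup>+u. ennreal (?G u) * indicator {0<..} u \<partial>lborel) + (\<integral>\<^sup>+u. ennreal (?G (- u)) * indicator {0<..} u \<partial>lborel)
     = (\<integral>\<^sup>+u. ennreal (?G u) + ennreal (?G (- u)) \<partial>lpos)"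
    unfolding nn_integral_lpos[symmetric]
    by (intro nn_integral_add[symmetric] measurable_lpos) measurable
  also have "\<dots> = (\<integral>\<^sup>+u. ennreal (2 * x powr (\<nu> / 2) * (exp (- (2 * sqrt x) * cosh u) * cosh (\<nu> * u))) \<partial>lpos)"
  proof (rule nn_integral_lpos_cong)
    fix u :: real
    have "?G u + ?G (- u) = 2 * x powr (\<nu> / 2) * (exp (- (2 * sqrt x) * cosh u) * cosh (\<nu> * u))"
      by (simp add: cosh_field_def[of "\<nu> * u"] algebra_simps)
    then show "ennreal (?G u) + ennreal (?G (- u)) = ennreal (2 * x powr (\<nu> / 2) * (exp (- (2 * sqrt x) * cosh u) * cosh (\<nu> * u)))"
      by (subst ennreal_plus[symmetric]) (auto simp del: ennreal_plus)
  qed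
  finally have RE: "rho_nn \<nu> x = (\<integral>\<^sup>+u. ennreal (2 * x powr (\<nu> / 2) * (exp (- (2 * sqrt x) * cosh u) * cosh (\<nu> * u))) \<partial>lpos)" .
  have "rho \<nu> x = (\<integral>u. 2 * x powr (\<nu> / 2) * (exp (- (2 * sqrt x) * cosh u) * cosh (\<nu> * u)) \<partial>lpos)"
    unfolding rho_def macdonald_K_def set_lebesgue_integral_lpos by simp
  also have "\<dots> = enn2real (rho_nn \<nu> x)"
    unfolding RE by (intro integral_eq_nn_integral measurable_lpos) (measurable, auto)
  finally show "rho_nn \<nu> x = ennreal (rho \<nu> x)" "0 \<le> rho \<nu> x"
    using rho_nn_finite[OF x, of \<nu>] by auto
qed


section \<open>The Beta integral and the moments of products of two weights\<close>

text \<open>\<open>Gamma (a + b) * (1 + y) powr (- (a + b))\<close> is itself a Gamma integral in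
  \<open>t\<close>. After the interchange the \<open>y\<close>-integral gives
  \<open>Gamma a * t powr (- a)\<close> and the \<open>t\<close>-integral gives
  \<open>Gamma b\<close>.\<close>

lemma nn_integral_Beta:
  fixes a b :: real
  assumes a: "0 < a" and b: "0 < b"
  shows "(\<integral>\<^sup>+y. ennreal (y powr (a - 1) * (1 + y) powr (- (a + b))) \<partial>lpos) = ennreal (Gamma a * Gamma b / Gamma (a + b))"
proof -
  let ?G = "ennreal (Gamma (a + b))"
  have "?G * (\<integral>\<^sup>+y. ennreal (y powr (a - 1) * (1 + y) powr (- (a + b))) \<partial>lpos)
      = (\<integral>\<^sup>+y. ennreal (y powr (a - 1)) * ennreal (Gamma (a + b) * (1 + y) powr (- (a + b))) \<partial>lpos)"
    using a b by (subst nn_integral_cmult[symmetric])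
      (auto intro!: nn_integral_lpos_cong measurable_lpos simp: ennreal_mult[symmetric] mult_ac Gamma_real_pos less_imp_le)
  also have "\<dots> = (\<integral>\<^sup>+y. ennreal (y powr (a - 1)) * (\<integral>\<^sup>+t. ennreal (t powr (a + b - 1) * exp (- (1 + y) * t)) \<partial>lpos) \<partial>lpos)"
  proof (intro nn_integral_lpos_cong)
    fix y :: real assume "0 < y"
    then show "ennreal (y powr (a - 1)) * ennreal (Gamma (a + b) * (1 + y) powr (- (a + b)))
      = ennreal (y powr (a - 1)) * (\<integral>\<^sup>+t. ennreal (t powr (a + b - 1) * exp (- (1 + y) * t)) \<partial>lpos)"
      using a b by (subst nn_integral_Gamma) auto
  qed
  also have "\<dots> = (\<integral>\<^sup>+y. \<integral>\<^sup>+t. ennreal (y powr (a - 1) * (t powr (a + b - 1) * exp (- (1 + y) * t))) \<partial>lpos \<partial>lpos)"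
    by (intro nn_integral_lpos_cong) (subst nn_integral_lpos_cmult, auto)
  also have "\<dots> = (\<integral>\<^sup>+t. \<integral>\<^sup>+y. ennreal (y powr (a - 1) * (t powr (a + b - 1) * exp (- (1 + y) * t))) \<partial>lpos \<partial>lpos)"
    by (rule tonelli_lpos) measurable
  also have "\<dots> = (\<integral>\<^sup>+t. ennreal (t powr (a + b - 1) * exp (- t)) * (\<integral>\<^sup>+y. ennreal (y powr (a - 1) * exp (- t * y)) \<partial>lpos) \<partial>lpos)"
    by (intro nn_integral_lpos_cong, subst nn_integral_lpos_cmult[symmetric])
       (auto intro!: nn_integral_lpos_cong simp: algebra_simps mult_exp_exp)
  also have "\<dots> = (\<integral>\<^sup>+t. ennreal (Gamma a * (t powr (b - 1) * exp (- 1 * t))) \<partial>lpos)"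
  proof (intro nn_integral_lpos_cong)
    fix t :: real assume t: "0 < t"
    have "t powr (a + b - 1) = t powr (b - 1) * t powr a"
      by (simp add: powr_add[symmetric] algebra_simps)
    then have "t powr (a + b - 1) * exp (- t) * (Gamma a * t powr (- a)) = Gamma a * (t powr (b - 1) * exp (- 1 * t))"
      using t by (simp add: powr_minus field_simps)
    then show "ennreal (t powr (a + b - 1) * exp (- t)) * (\<integral>\<^sup>+y. ennreal (y powr (a - 1) * exp (- t * y)) \<partial>lpos)
        = ennreal (Gamma a * (t powr (b - 1) * exp (- 1 * t)))"
      unfolding nn_integral_Gamma[OF a t]
      using t a by (simp only: ennreal_mult'[symmetric] mult_nonneg_nonneg powr_ge_zero exp_ge_zero)
  qed
  also have "\<dots> = ennreal (Gamma a * Gamma b)"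
    using a b nn_integral_Gamma[OF b, of 1]
    by (subst nn_integral_lpos_cmult) (auto simp: ennreal_mult'[symmetric] Gamma_real_pos less_imp_le)
  finally have "ennreal (1 / Gamma (a + b)) * (?G * (\<integral>\<^sup>+y. ennreal (y powr (a - 1) * (1 + y) powr (- (a + b))) \<partial>lpos))
     = ennreal (1 / Gamma (a + b)) * ennreal (Gamma a * Gamma b)" by simp
  then show ?thesis
    using a b less_imp_neq[OF Gamma_real_pos, of "a + b"]
    by (simp add: mult.assoc[symmetric] ennreal_mult'[symmetric] field_simps)
qed

text \<open>For fixed \<open>t\<close> the \<open>x\<close>-integral is a Gamma integral with rate
  \<open>c + 1 / t = (1 + c * t) / t\<close>.\<close>

lemma nn_integral_power_rho_nn:
  assumes s: "0 < \<nu> + real k + 1"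
    and c: "0 \<le> c"
  shows "(\<integral>\<^sup>+x. ennreal (x ^ k * exp (- c * x)) * rho_nn \<nu> x \<partial>lpos)
    = (\<integral>\<^sup>+t. ennreal (fact k * (t powr (\<nu> + k) * exp (- t) * (1 + c * t) powr (- real (Suc k)))) \<partial>lpos)"
proof -
  have "(\<integral>\<^sup>+x. ennreal (x ^ k * exp (- c * x)) * rho_nn \<nu> x \<partial>lpos)
    = (\<integral>\<^sup>+x. \<integral>\<^sup>+t. ennreal (x ^ k * exp (- c * x) * (t powr (\<nu> - 1) * exp (- t - x / t))) \<partial>lpos \<partial>lpos)"
    unfolding rho_nn_def by (intro nn_integral_lpos_cong) (subst nn_integral_lpos_cmult, auto)
  also have "\<dots> = (\<integral>\<^sup>+t. \<integral>\<^sup>+x. ennreal (x ^ k * exp (- c * x) * (t powr (\<nu> - 1) * exp (- t - x / t))) \<partial>lpos \<partial>lpos)"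
    by (rule tonelli_lpos) measurable
  also have "\<dots> = (\<integral>\<^sup>+t. ennreal (t powr (\<nu> - 1) * exp (- t)) * (\<integral>\<^sup>+x. ennreal (x ^ k * exp (- ((1 + c * t) / t) * x)) \<partial>lpos) \<partial>lpos)"
    by (intro nn_integral_lpos_cong, subst nn_integral_lpos_cmult[symmetric])
       (auto intro!: nn_integral_lpos_cong arg_cong[where f=ennreal] simp: mult_exp_exp field_simps)
  also have "\<dots> = (\<integral>\<^sup>+t. ennreal (fact k * (t powr (\<nu> + k) * exp (- t) * (1 + c * t) powr (- real (Suc k)))) \<partial>lpos)"
  proof (intro nn_integral_lpos_cong)
    fix t :: real assume t: "0 < t"
    have p: "0 < 1 + c * t" using c t by (simp add: add_pos_nonneg)
    have "((1 + c * t) / t) powr (- real (Suc k)) = (1 + c * t) powr (- real (Suc k)) * t powr (real (Suc k))"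
      using p t by (simp add: powr_divide powr_minus field_simps del: of_nat_Suc)
    moreover have "t powr (\<nu> + k) = t powr (\<nu> - 1) * t powr (real (Suc k))"
      by (simp add: powr_add[symmetric])
    ultimately show "ennreal (t powr (\<nu> - 1) * exp (- t)) * (\<integral>\<^sup>+x. ennreal (x ^ k * exp (- ((1 + c * t) / t) * x)) \<partial>lpos)
        = ennreal (fact k * (t powr (\<nu> + k) * exp (- t) * (1 + c * t) powr (- real (Suc k))))"
      using p t by (subst nn_integral_Gamma_power) (auto simp del: of_nat_Suc simp: ennreal_mult'[symmetric] mult_ac)
  qed
  finally show ?thesis .
qed

text \<open>Writing the second weight as an integral over \<open>s\<close> makes the
  \<open>x\<close>-integral an instance of the previous lemma with \<open>c = 1 / s\<close>. The
  scaling \<open>t = s * y\<close> separates the variables: \<open>s\<close> gives a Gamma integral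
  and \<open>y\<close> a Beta integral.\<close>

lemma nn_integral_power_rho_nn_rho_nn:
  assumes 1: "0 < real k + \<nu> + 1" and 2: "0 < real k + \<mu> + 1" and 3: "0 < real k + \<nu> + \<mu> + 1"
  shows "(\<integral>\<^sup>+x. ennreal (x ^ k) * rho_nn \<nu> x * rho_nn \<mu> x \<partial>lpos)
    = ennreal (fact k * Gamma (k + \<nu> + 1) * Gamma (k + \<mu> + 1) * Gamma (k + \<nu> + \<mu> + 1) / Gamma (2 * real k + \<nu> + \<mu> + 2))"
proof -
  have "(\<integral>\<^sup>+x. ennreal (x ^ k) * rho_nn \<nu> x * rho_nn \<mu> x \<partial>lpos)
    = (\<integral>\<^sup>+x. \<integral>\<^sup>+s. ennreal (x ^ k) * rho_nn \<nu> x * ennreal (s powr (\<mu> - 1) * exp (- s - x / s)) \<partial>lpos \<partial>lpos)"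
    by (subst (2) rho_nn_def, subst nn_integral_cmult) (auto intro!: measurable_lpos)
  also have "\<dots> = (\<integral>\<^sup>+s. \<integral>\<^sup>+x. ennreal (x ^ k) * rho_nn \<nu> x * ennreal (s powr (\<mu> - 1) * exp (- s - x / s)) \<partial>lpos \<partial>lpos)"
    by (rule tonelli_lpos) measurable
  also have "\<dots> = (\<integral>\<^sup>+s. ennreal (s powr (\<mu> - 1) * exp (- s)) * (\<integral>\<^sup>+x. ennreal (x ^ k * exp (- (1 / s) * x)) * rho_nn \<nu> x \<partial>lpos) \<partial>lpos)"
    by (intro nn_integral_lpos_cong, subst nn_integral_cmult[symmetric])
       (auto intro!: nn_integral_lpos_cong measurable_lpos simp: ennreal_mult mult_ac exp_diff exp_minus divide_inverse)
  also have "\<dots> = (\<integral>\<^sup>+s. ennreal (s powr (\<mu> - 1) * exp (- s)) *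
      (ennreal s * (\<integral>\<^sup>+y. ennreal (fact k * ((s * y) powr (\<nu> + k) * exp (- (s * y)) * (1 + (1 / s) * (s * y)) powr (- real (Suc k)))) \<partial>lpos)) \<partial>lpos)"
  proof (intro nn_integral_lpos_cong arg_cong[where f="\<lambda>z. _ * z"])
    fix s :: real assume s: "0 < s"
    have "(\<integral>\<^sup>+x. ennreal (x ^ k * exp (- (1 / s) * x)) * rho_nn \<nu> x \<partial>lpos)
      = (\<integral>\<^sup>+t. ennreal (fact k * (t powr (\<nu> + k) * exp (- t) * (1 + (1 / s) * t) powr (- real (Suc k)))) \<partial>lpos)"
      using 1 s by (intro nn_integral_power_rho_nn) auto
    also have "\<dots> = ennreal s * (\<integral>\<^sup>+y. ennreal (fact k * ((s * y) powr (\<nu> + k) * exp (- (s * y)) * (1 + (1 / s) * (s * y)) powr (- real (Suc k)))) \<partial>lpos)"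
      by (rule nn_integral_lpos_scale[OF _ s]) measurable
    finally show "(\<integral>\<^sup>+x. ennreal (x ^ k * exp (- (1 / s) * x)) * rho_nn \<nu> x \<partial>lpos) = \<dots>" .
  qed
  also have "\<dots> = (\<integral>\<^sup>+s. \<integral>\<^sup>+y. ennreal (fact k * y powr (\<nu> + k) * (1 + y) powr (- real (Suc k)) *
      (s powr (k + \<nu> + \<mu>) * exp (- (1 + y) * s))) \<partial>lpos \<partial>lpos)"
  proof (intro nn_integral_lpos_cong)
    fix s :: real assume s: "0 < s"
    have "fact k * y powr (\<nu> + k) * (1 + y) powr (- real (Suc k)) * (s powr (k + \<nu> + \<mu>) * exp (- (1 + y) * s))
       = s powr (\<mu> - 1) * exp (- s) * (s * (fact k * ((s * y) powr (\<nu> + k) * exp (- (s * y)) * (1 + (1 / s) * (s * y)) powr (- real (Suc k)))))"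
      if y: "0 < y" for y
    proof -
      have "exp (- (1 + y) * s) = exp (- s) * exp (- (s * y))"
        by (simp add: mult_exp_exp algebra_simps)
      moreover have "s powr (k + \<nu> + \<mu>) = s powr (\<mu> - 1) * s * s powr (\<nu> + k)"
        using s by (simp add: powr_add[symmetric] powr_diff algebra_simps)
      moreover have "(s * y) powr (\<nu> + k) = s powr (\<nu> + k) * y powr (\<nu> + k)"
        using s y by (simp add: powr_mult)
      moreover have "1 + (1 / s) * (s * y) = 1 + y" using s by simp
      ultimately show ?thesis by (simp only: mult_ac)
    qed
    then have "(\<integral>\<^sup>+y. ennreal (fact k * y powr (\<nu> + k) * (1 + y) powr (- real (Suc k)) * (s powr (k + \<nu> + \<mu>) * exp (- (1 + y) * s))) \<partial>lpos)
      = (\<integral>\<^sup>+y. ennreal (s powr (\<mu> - 1) * exp (- s) * (s * (fact k * ((s * y) powr (\<nu> + k) * exp (- (s * y)) * (1 + (1 / s) * (s * y)) powr (- real (Suc k)))))) \<partial>lpos)"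
      by (intro nn_integral_lpos_cong) (simp only:)
    also have "\<dots> = ennreal (s powr (\<mu> - 1) * exp (- s)) * (\<integral>\<^sup>+y. ennreal (s * (fact k * ((s * y) powr (\<nu> + k) * exp (- (s * y)) * (1 + (1 / s) * (s * y)) powr (- real (Suc k))))) \<partial>lpos)"
      using s by (intro nn_integral_lpos_cmult) auto
    also have "(\<integral>\<^sup>+y. ennreal (s * (fact k * ((s * y) powr (\<nu> + k) * exp (- (s * y)) * (1 + (1 / s) * (s * y)) powr (- real (Suc k))))) \<partial>lpos)
      = ennreal s * (\<integral>\<^sup>+y. ennreal (fact k * ((s * y) powr (\<nu> + k) * exp (- (s * y)) * (1 + (1 / s) * (s * y)) powr (- real (Suc k)))) \<partial>lpos)"
      using s by (intro nn_integral_lpos_cmult) auto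
    finally show "ennreal (s powr (\<mu> - 1) * exp (- s)) *
      (ennreal s * (\<integral>\<^sup>+y. ennreal (fact k * ((s * y) powr (\<nu> + k) * exp (- (s * y)) * (1 + (1 / s) * (s * y)) powr (- real (Suc k)))) \<partial>lpos))
      = (\<integral>\<^sup>+y. ennreal (fact k * y powr (\<nu> + k) * (1 + y) powr (- real (Suc k)) *
      (s powr (k + \<nu> + \<mu>) * exp (- (1 + y) * s))) \<partial>lpos)" ..
  qed
  also have "\<dots> = (\<integral>\<^sup>+y. \<integral>\<^sup>+s. ennreal (fact k * y powr (\<nu> + k) * (1 + y) powr (- real (Suc k)) *
      (s powr (k + \<nu> + \<mu>) * exp (- (1 + y) * s))) \<partial>lpos \<partial>lpos)"
    by (rule tonelli_lpos) measurable
  also have "\<dots> = (\<integral>\<^sup>+y. ennreal (fact k * y powr (\<nu> + k) * (1 + y) powr (- real (Suc k)) *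
      (Gamma (k + \<nu> + \<mu> + 1) * (1 + y) powr (- (k + \<nu> + \<mu> + 1)))) \<partial>lpos)"
  proof (intro nn_integral_lpos_cong)
    fix y :: real assume "0 < y"
    then show "(\<integral>\<^sup>+s. ennreal (fact k * y powr (\<nu> + k) * (1 + y) powr (- real (Suc k)) *
      (s powr (k + \<nu> + \<mu>) * exp (- (1 + y) * s))) \<partial>lpos) = ennreal (fact k * y powr (\<nu> + k) * (1 + y) powr (- real (Suc k)) *
      (Gamma (k + \<nu> + \<mu> + 1) * (1 + y) powr (- (k + \<nu> + \<mu> + 1))))"
      using nn_integral_Gamma[OF 3, of "1 + y"]
      by (subst nn_integral_lpos_cmult) (auto simp: ennreal_mult'[symmetric])
  qed
  also have "\<dots> = (\<integral>\<^sup>+y. ennreal (fact k * Gamma (k + \<nu> + \<mu> + 1) *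
      (y powr (k + \<nu> + 1 - 1) * (1 + y) powr (- ((k + \<nu> + 1) + (k + \<mu> + 1))))) \<partial>lpos)"
  proof (intro nn_integral_lpos_cong arg_cong[where f=ennreal])
    fix y :: real
    \<comment> \<open>The exponents \<open>k + 1\<close> and \<open>k + \<nu> + \<mu> + 1\<close>
      are regrouped into the two Beta parameters.\<close>
    have "(1 + y) powr (- ((k + \<nu> + 1) + (k + \<mu> + 1))) = (1 + y) powr (- real (Suc k)) * (1 + y) powr (- (k + \<nu> + \<mu> + 1))"
      by (simp only: powr_add[symmetric]) (rule arg_cong[where f="\<lambda>z. (1 + y) powr z"], simp)
    then show "fact k * y powr (\<nu> + k) * (1 + y) powr (- real (Suc k)) *
      (Gamma (k + \<nu> + \<mu> + 1) * (1 + y) powr (- (k + \<nu> + \<mu> + 1)))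
      = fact k * Gamma (k + \<nu> + \<mu> + 1) *
      (y powr (k + \<nu> + 1 - 1) * (1 + y) powr (- ((k + \<nu> + 1) + (k + \<mu> + 1))))"
      by (simp add: mult_ac add_ac)
  qed
  also have "\<dots> = ennreal (fact k * Gamma (k + \<nu> + \<mu> + 1)) * ennreal (Gamma (k + \<nu> + 1) * Gamma (k + \<mu> + 1) / Gamma ((k + \<nu> + 1) + (k + \<mu> + 1)))"
    using 3 by (subst nn_integral_Beta[OF 1 2, symmetric], subst nn_integral_lpos_cmult)
       (auto simp: Gamma_real_pos less_imp_le)
  also have "\<dots> = ennreal (fact k * Gamma (k + \<nu> + 1) * Gamma (k + \<mu> + 1) * Gamma (k + \<nu> + \<mu> + 1) / Gamma (2 * real k + \<nu> + \<mu> + 2))"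
    using 3 by (simp add: ennreal_mult'[symmetric] Gamma_real_pos less_imp_le mult_ac add_ac)
  finally show ?thesis .
qed

section \<open>The Laplace transform of the weight\<close>

text \<open>The power \<open>k\<close> is an index because each differentiation in \<open>s\<close>
  raises it by one.\<close>

definition lap :: "real \<Rightarrow> nat \<Rightarrow> real \<Rightarrow> real" where
  "lap \<nu> k s = (\<integral>x. x ^ k * rho \<nu> x * exp (- s * x) \<partial>lpos)"

lemma rho_measurable [measurable]: "rho \<nu> \<in> borel_measurable lpos"
proof -
  have "(\<lambda>x. enn2real (rho_nn \<nu> x)) \<in> borel_measurable lpos"
    by (rule measurable_lpos) measurable
  then show ?thesis
    by (subst measurable_cong[where g="\<lambda>x. enn2real (rho_nn \<nu> x)"]) (auto simp: rho_nn_eq)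
qed

lemma borel_measurable_lpos_times_rho:
  "f \<in> borel_measurable borel \<Longrightarrow> (\<lambda>x. f x * rho \<nu> x) \<in> borel_measurable lpos"
  by (intro borel_measurable_times measurable_lpos rho_measurable)

text \<open>In the formula for the integral the factor
  \<open>(1 + s * t) powr (- real (Suc k))\<close> is at most 1, which leaves
  \<open>Gamma (\<nu> + k + 1)\<close>, up to \<open>fact k\<close>, as a finite bound.\<close>

lemma integral_lap:
  assumes nu: "- 1 < \<nu>" and s: "0 \<le> s"
  shows "integrable lpos (\<lambda>x. x ^ k * rho \<nu> x * exp (- s * x))"
    and "(\<integral>\<^sup>+x. ennreal (x ^ k * exp (- s * x)) * rho_nn \<nu> x \<partial>lpos) = ennreal (lap \<nu> k s)"
    and "0 \<le> lap \<nu> k s"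
proof -
  have eq: "(\<integral>\<^sup>+x. ennreal (x ^ k * exp (- s * x)) * rho_nn \<nu> x \<partial>lpos)
      = (\<integral>\<^sup>+x. ennreal (x ^ k * rho \<nu> x * exp (- s * x)) \<partial>lpos)"
    by (intro nn_integral_lpos_cong) (simp add: rho_nn_eq ennreal_mult'[symmetric] mult_ac)
  have "(\<integral>\<^sup>+x. ennreal (x ^ k * exp (- s * x)) * rho_nn \<nu> x \<partial>lpos)
     = (\<integral>\<^sup>+t. ennreal (fact k * (t powr (\<nu> + k) * exp (- t) * (1 + s * t) powr (- real (Suc k)))) \<partial>lpos)"
    using nu s by (intro nn_integral_power_rho_nn) auto
  also have "\<dots> \<le> (\<integral>\<^sup>+t. ennreal (fact k * (t powr (\<nu> + k + 1 - 1) * exp (- 1 * t))) \<partial>lpos)"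
  proof (intro nn_integral_mono ennreal_leI mult_left_mono)
    fix t assume "t \<in> space lpos"
    then have "(1 + s * t) powr (- real (Suc k)) \<le> 1 powr (- real (Suc k))"
      using s by (intro powr_mono2') auto
    then show "t powr (\<nu> + k) * exp (- t) * (1 + s * t) powr (- real (Suc k)) \<le> t powr (\<nu> + k + 1 - 1) * exp (- 1 * t)"
      by (simp add: mult_left_le)
  qed auto
  also have "\<dots> = ennreal (fact k) * (\<integral>\<^sup>+t. ennreal (t powr (\<nu> + k + 1 - 1) * exp (- 1 * t)) \<partial>lpos)"
    by (intro nn_integral_lpos_cmult) auto
  also have "\<dots> < \<infinity>"
    using nu by (subst nn_integral_Gamma) (auto simp: ennreal_mult_less_top)
  finally have fin: "(\<integral>\<^sup>+x. ennreal (x ^ k * rho \<nu> x * exp (- s * x)) \<partial>lpos) < \<infinity>"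
    unfolding eq .
  have m: "(\<lambda>x. x ^ k * rho \<nu> x * exp (- s * x)) \<in> borel_measurable lpos"
    by (intro borel_measurable_times borel_measurable_lpos_times_rho measurable_lpos) measurable
  have nn: "AE x in lpos. 0 \<le> x ^ k * rho \<nu> x * exp (- s * x)"
    by (auto simp: rho_nn_eq)
  show i: "integrable lpos (\<lambda>x. x ^ k * rho \<nu> x * exp (- s * x))"
    using fin nn m by (intro integrableI_nonneg)
  show "(\<integral>\<^sup>+x. ennreal (x ^ k * exp (- s * x)) * rho_nn \<nu> x \<partial>lpos) = ennreal (lap \<nu> k s)"
    unfolding eq lap_def by (rule nn_integral_eq_integral[OF i nn])
  show "0 \<le> lap \<nu> k s"
    unfolding lap_def by (rule integral_nonneg_AE[OF nn])
qed

text \<open>Follows from \<open>1 - exp (- x) \<le> x\<close>; it makes difference quotients of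
  \<open>exp (- s * x)\<close> in \<open>s\<close> bounded by \<open>x\<close>.\<close>

lemma abs_exp_minus_diff_le:
  fixes a b :: real
  assumes "0 \<le> a" "0 \<le> b"
  shows "\<bar>exp (- a) - exp (- b)\<bar> \<le> \<bar>a - b\<bar>"
proof -
  have *: "\<bar>exp (- a) - exp (- b)\<bar> \<le> \<bar>a - b\<bar>" if "0 \<le> a" "a \<le> b" for a b :: real
  proof -
    have "exp (- a) - exp (- b) = exp (- a) * (1 - exp (- (b - a)))"
      by (simp add: algebra_simps mult_exp_exp)
    moreover have "1 - exp (- (b - a)) \<le> b - a"
      using exp_ge_add_one_self[of "- (b - a)"] by linarith
    then have "exp (- a) * (1 - exp (- (b - a))) \<le> 1 * (b - a)"
      using that by (intro mult_mono) auto
    ultimately show ?thesis using that by simp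
  qed
  show ?thesis
    using *[of a b] *[of b a] assms by (cases "a \<le> b") auto
qed

text \<open>Differentiation under the integral by dominated convergence along sequences, with
  \<open>\<bar>x * f x\<bar>\<close> dominating the difference quotients.\<close>

lemma has_real_derivative_laplace:
  fixes f :: "real \<Rightarrow> real"
  assumes f: "integrable lpos f" and xf: "integrable lpos (\<lambda>x. x * f x)" and s: "0 < s"
  shows "((\<lambda>s. \<integral>x. f x * exp (- s * x) \<partial>lpos) has_real_derivative
    - (\<integral>x. x * f x * exp (- s * x) \<partial>lpos)) (at s)"
proof -
  have [measurable]: "f \<in> borel_measurable lpos" using f by auto
  have m: "(\<lambda>x. exp (- y * x)) \<in> borel_measurable lpos" for y :: real
    by (rule measurable_lpos) measurable
  have int: "integrable lpos (\<lambda>x. f x * exp (- y * x))" if "0 < y" for y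
  proof (rule Bochner_Integration.integrable_bound[OF f])
    show "(\<lambda>x. f x * exp (- y * x)) \<in> borel_measurable lpos"
      using m by (intro borel_measurable_times) auto
    show "AE x in lpos. norm (f x * exp (- y * x)) \<le> norm (f x)"
      using that by (intro AE_I2) (auto simp: abs_mult intro!: mult_left_le)
  qed
  let ?F = "\<lambda>s. \<integral>x. f x * exp (- s * x) \<partial>lpos"
  \<comment> \<open>Restricting to positive parameters keeps every exponential at most 1; as the
    half-line is open, the limit is still two-sided.\<close>
  have "((\<lambda>y. (?F y - ?F s) / (y - s)) \<longlongrightarrow> - (\<integral>x. x * f x * exp (- s * x) \<partial>lpos)) (at s within {0<..})"
    unfolding tendsto_at_iff_sequentially
  proof (intro allI impI)
    fix X :: "nat \<Rightarrow> real" assume X: "\<forall>i. X i \<in> {0<..} - {s}" "X \<longlonglongrightarrow> s"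
    let ?q = "\<lambda>n x. f x * ((exp (- X n * x) - exp (- s * x)) / (X n - s))"
    have lim: "(\<lambda>n. \<integral>x. ?q n x \<partial>lpos) \<longlonglongrightarrow> (\<integral>x. f x * (- x * exp (- s * x)) \<partial>lpos)"
    proof (rule integral_dominated_convergence[where w="\<lambda>x. norm (x * f x)"])
      show "(\<lambda>x. f x * (- x * exp (- s * x))) \<in> borel_measurable lpos"
        by (intro borel_measurable_times borel_measurable_uminus m \<open>f \<in> borel_measurable lpos\<close> measurable_lpos[OF measurable_ident_sets]) auto
      show "?q n \<in> borel_measurable lpos" for n
        by (intro borel_measurable_times borel_measurable_divide borel_measurable_diff borel_measurable_const m \<open>f \<in> borel_measurable lpos\<close>)
      show "integrable lpos (\<lambda>x. norm (x * f x))"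
        using xf by (rule integrable_norm)
      show "AE x in lpos. (\<lambda>n. ?q n x) \<longlonglongrightarrow> f x * (- x * exp (- s * x))"
      proof (rule AE_I2)
        fix x :: real
        have "((\<lambda>y. exp (- y * x)) has_real_derivative - x * exp (- s * x)) (at s)"
          by (auto intro!: derivative_eq_intros)
        then have "((\<lambda>y. (exp (- y * x) - exp (- s * x)) / (y - s)) \<longlongrightarrow> - x * exp (- s * x)) (at s)"
          by (simp add: has_field_derivative_iff)
        then have "(\<lambda>n. (exp (- X n * x) - exp (- s * x)) / (X n - s)) \<longlonglongrightarrow> - x * exp (- s * x)"
        proof (rule filterlim_compose)
          show "filterlim X (at s) sequentially"
            using X by (auto simp: filterlim_at)
        qed
        then show "(\<lambda>n. ?q n x) \<longlonglongrightarrow> f x * (- x * exp (- s * x))"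
          by (intro tendsto_mult tendsto_const)
      qed
      show "AE x in lpos. norm (?q n x) \<le> norm (x * f x)" for n
      proof (rule AE_I2)
        fix x assume "x \<in> space lpos"
        then have x: "0 < x" by simp
        have Xn: "0 < X n" "X n \<noteq> s" using X by auto
        have "\<bar>exp (- X n * x) - exp (- s * x)\<bar> \<le> \<bar>X n * x - s * x\<bar>"
          using abs_exp_minus_diff_le[of "X n * x" "s * x"] x Xn s by simp
        also have "\<dots> = x * \<bar>X n - s\<bar>"
          using x by (simp add: left_diff_distrib[symmetric] abs_mult)
        finally have "\<bar>(exp (- X n * x) - exp (- s * x)) / (X n - s)\<bar> \<le> x"
          using Xn by (simp add: divide_le_eq)
        then have "\<bar>f x\<bar> * \<bar>(exp (- X n * x) - exp (- s * x)) / (X n - s)\<bar> \<le> \<bar>f x\<bar> * x"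
          by (rule mult_left_mono) simp
        then show "norm (?q n x) \<le> norm (x * f x)"
          using x unfolding real_norm_def abs_mult by (simp add: mult.commute)
      qed
    qed
    have q: "(\<integral>x. ?q n x \<partial>lpos) = (?F (X n) - ?F s) / (X n - s)" for n
    proof -
      have "0 < X n" using X by auto
      then have "?F (X n) - ?F s = (\<integral>x. f x * exp (- X n * x) - f x * exp (- s * x) \<partial>lpos)"
        using int s by (intro Bochner_Integration.integral_diff[symmetric]) auto
      then have "(?F (X n) - ?F s) / (X n - s) = (\<integral>x. (f x * exp (- X n * x) - f x * exp (- s * x)) / (X n - s) \<partial>lpos)"
        by (simp only: integral_divide_zero)
      also have "\<dots> = (\<integral>x. ?q n x \<partial>lpos)"
        by (simp add: right_diff_distrib)
      finally show ?thesis by (rule sym)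
    qed
    have D: "(\<integral>x. f x * (- x * exp (- s * x)) \<partial>lpos) = - (\<integral>x. x * f x * exp (- s * x) \<partial>lpos)"
      by (subst Bochner_Integration.integral_minus[symmetric]) (simp add: mult_ac)
    have "((\<lambda>y. (?F y - ?F s) / (y - s)) \<circ> X) = (\<lambda>n. \<integral>x. ?q n x \<partial>lpos)"
      unfolding comp_def by (rule ext) (rule q[symmetric])
    then show "((\<lambda>y. (?F y - ?F s) / (y - s)) \<circ> X) \<longlonglongrightarrow> - (\<integral>x. x * f x * exp (- s * x) \<partial>lpos)"
      unfolding D[symmetric] by (rule ssubst[where P="\<lambda>g. g \<longlonglongrightarrow> (\<integral>x. f x * (- x * exp (- s * x)) \<partial>lpos)"]) (rule lim)
  qed
  moreover have "at s within {0<..} = at s"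
    using s by (intro at_within_open) auto
  ultimately show ?thesis
    unfolding has_field_derivative_iff by (simp only:)
qed

lemma has_real_derivative_lap:
  assumes nu: "- 1 < \<nu>" and s: "0 < s"
  shows "(lap \<nu> k has_real_derivative - lap \<nu> (Suc k) s) (at s)"
proof -
  have "integrable lpos (\<lambda>x. x ^ k * rho \<nu> x)" "integrable lpos (\<lambda>x. x * (x ^ k * rho \<nu> x))"
    using integral_lap(1)[OF nu, of 0 k] integral_lap(1)[OF nu, of 0 "Suc k"]
    by (simp_all add: mult.assoc)
  from has_real_derivative_laplace[OF this s] show ?thesis
    unfolding lap_def[abs_def] by (simp add: mult_ac)
qed

section \<open>Iterates of \<open>theta\<close> as Laplace transforms\<close>

text \<open>Both sides reduce to \<open>?K\<close>. In the incomplete Gamma integral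
  \<open>?J\<close> the power of \<open>v\<close> is replaced by a Gamma integral over
  \<open>u\<close> and \<open>v\<close> is integrated first; in the Laplace transform the variable
  is scaled by \<open>t\<close>.\<close>

lemma lap_0_eq:
  assumes nu: "- 1 < \<nu>" and t: "0 < t"
  shows "t powr \<nu> * exp t * inc_Gamma (- \<nu>) t = lap \<nu> 0 (1 / t) / (Gamma (1 + \<nu>) * t)"
proof -
  let ?J = "\<integral>\<^sup>+v. ennreal (exp (- v) * v powr (- (1 + \<nu>))) * indicator {t<..} v \<partial>lpos"
  let ?K = "\<integral>\<^sup>+u. ennreal (u powr \<nu> * exp (- t * u) * (1 + u) powr (- 1)) \<partial>lpos"
  have G: "0 < Gamma (1 + \<nu>)" using nu by (simp add: Gamma_real_pos)
  have "ennreal (Gamma (1 + \<nu>)) * ?J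
     = (\<integral>\<^sup>+v. ennreal (exp (- v)) * indicator {t<..} v * ennreal (Gamma (1 + \<nu>) * v powr (- (1 + \<nu>))) \<partial>lpos)"
    using G by (subst nn_integral_cmult[symmetric])
      (auto intro!: nn_integral_lpos_cong measurable_lpos simp: ennreal_mult'[symmetric] mult_ac indicator_def)
  also have "\<dots> = (\<integral>\<^sup>+v. \<integral>\<^sup>+u. ennreal (exp (- v)) * indicator {t<..} v * ennreal (u powr \<nu> * exp (- v * u)) \<partial>lpos \<partial>lpos)"
  proof (intro nn_integral_lpos_cong)
    fix v :: real assume "0 < v"
    then have "ennreal (Gamma (1 + \<nu>) * v powr (- (1 + \<nu>))) = (\<integral>\<^sup>+u. ennreal (u powr \<nu> * exp (- v * u)) \<partial>lpos)"
      using nn_integral_Gamma[of "1 + \<nu>" v] nu by simp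
    then show "ennreal (exp (- v)) * indicator {t<..} v * ennreal (Gamma (1 + \<nu>) * v powr (- (1 + \<nu>)))
        = (\<integral>\<^sup>+u. ennreal (exp (- v)) * indicator {t<..} v * ennreal (u powr \<nu> * exp (- v * u)) \<partial>lpos)"
      by (simp only:) (rule nn_integral_cmult[symmetric], rule measurable_lpos, measurable)
  qed
  also have "\<dots> = (\<integral>\<^sup>+u. \<integral>\<^sup>+v. ennreal (exp (- v)) * indicator {t<..} v * ennreal (u powr \<nu> * exp (- v * u)) \<partial>lpos \<partial>lpos)"
    by (rule tonelli_lpos) measurable
  also have "\<dots> = (\<integral>\<^sup>+u. ennreal (exp (- t)) * ennreal (u powr \<nu> * exp (- t * u) * (1 + u) powr (- 1)) \<partial>lpos)"
  proof (intro nn_integral_lpos_cong)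
    fix u :: real assume u: "0 < u"
    have "(\<integral>\<^sup>+v. ennreal (exp (- v)) * indicator {t<..} v * ennreal (u powr \<nu> * exp (- v * u)) \<partial>lpos)
      = (\<integral>\<^sup>+v. ennreal (u powr \<nu> * exp (- (1 + u) * v)) * indicator {t<..} v \<partial>lpos)"
      by (intro nn_integral_lpos_cong)
         (auto simp: indicator_def ennreal_mult'[symmetric] mult_exp_exp algebra_simps)
    also have "\<dots> = (\<integral>\<^sup>+v. ennreal (u powr \<nu> * exp (- (1 + u) * (t + v))) \<partial>lpos)"
      using t by (intro nn_integral_lpos_shift) auto
    also have "\<dots> = (\<integral>\<^sup>+v. ennreal (u powr \<nu> * exp (- (1 + u) * t) * (v ^ 0 * exp (- (1 + u) * v))) \<partial>lpos)"
      by (intro nn_integral_lpos_cong arg_cong[where f=ennreal]) (simp add: mult_exp_exp algebra_simps)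
    also have "\<dots> = ennreal (u powr \<nu> * exp (- (1 + u) * t)) * ennreal (fact 0 * (1 + u) powr (- real (Suc 0)))"
      using u by (subst nn_integral_lpos_cmult) (auto simp: nn_integral_Gamma_power[of "1 + u" 0, simplified])
    also have "\<dots> = ennreal (exp (- t)) * ennreal (u powr \<nu> * exp (- t * u) * (1 + u) powr (- 1))"
    proof -
      have "exp (- (1 + u) * t) = exp (- t) * exp (- t * u)"
        by (simp add: mult_exp_exp algebra_simps)
      then show ?thesis
        by (simp add: ennreal_mult'[symmetric] mult_ac)
    qed
    finally show "(\<integral>\<^sup>+v. ennreal (exp (- v)) * indicator {t<..} v * ennreal (u powr \<nu> * exp (- v * u)) \<partial>lpos) = \<dots>" .
  qed
  also have "\<dots> = ennreal (exp (- t)) * ?K"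
    by (rule nn_integral_cmult, rule measurable_lpos) measurable
  finally have 1: "ennreal (Gamma (1 + \<nu>)) * ?J = ennreal (exp (- t)) * ?K" .
  have "ennreal (lap \<nu> 0 (1 / t)) = (\<integral>\<^sup>+w. ennreal (w powr \<nu> * exp (- w) * (1 + w / t) powr (- 1)) \<partial>lpos)"
    using integral_lap(2)[OF nu, of "1 / t" 0] nn_integral_power_rho_nn[of \<nu> 0 "1 / t"] nu t
    by simp
  also have "\<dots> = ennreal t * (\<integral>\<^sup>+u. ennreal ((t * u) powr \<nu> * exp (- (t * u)) * (1 + (t * u) / t) powr (- 1)) \<partial>lpos)"
    by (rule nn_integral_lpos_scale[OF _ t]) measurable
  also have "(\<integral>\<^sup>+u. ennreal ((t * u) powr \<nu> * exp (- (t * u)) * (1 + (t * u) / t) powr (- 1)) \<partial>lpos)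
      = (\<integral>\<^sup>+u. ennreal (t powr \<nu>) * ennreal (u powr \<nu> * exp (- t * u) * (1 + u) powr (- 1)) \<partial>lpos)"
    using t by (intro nn_integral_lpos_cong) (auto simp: powr_mult ennreal_mult'[symmetric] mult_ac)
  also have "\<dots> = ennreal (t powr \<nu>) * ?K"
    by (rule nn_integral_cmult, rule measurable_lpos) measurable
  finally have 2: "ennreal (lap \<nu> 0 (1 / t)) = ennreal t * (ennreal (t powr \<nu>) * ?K)" .
  \<comment> \<open>Inserting \<open>exp t * exp (- t) = 1\<close> exposes the right-hand side of
    equation \<open>1\<close>, so that \<open>?K\<close> can be exchanged for
    \<open>?J\<close>.\<close>
  have "?K = ennreal (exp t) * (ennreal (exp (- t)) * ?K)"
    by (simp add: mult.assoc[symmetric] ennreal_mult'[symmetric] mult_exp_exp)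
  with 2 have 3: "ennreal (lap \<nu> 0 (1 / t)) = ennreal (Gamma (1 + \<nu>) * t * t powr \<nu> * exp t) * ?J"
    using G t unfolding 1[symmetric] by (simp add: ennreal_mult' mult_ac)
  have "?J = (\<integral>\<^sup>+v. ennreal (indicator {t<..} v * (exp (- v) * v powr (- (1 + \<nu>)))) \<partial>lborel)"
    unfolding nn_integral_lpos using t by (intro nn_integral_cong) (auto simp: indicator_def)
  moreover have "- \<nu> - 1 = - (1 + \<nu>)" by simp
  ultimately have "enn2real ?J = inc_Gamma (- \<nu>) t"
    unfolding inc_Gamma_def set_lebesgue_integral_def
    by (subst integral_eq_nn_integral) (auto simp: minus_diff_commute)
  with arg_cong[OF 3, of enn2real] have "lap \<nu> 0 (1 / t) = Gamma (1 + \<nu>) * t * t powr \<nu> * exp t * inc_Gamma (- \<nu>) t"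
    using G t integral_lap(3)[OF nu, of "1 / t" 0] by (simp add: enn2real_mult)
  then show ?thesis using G t by simp
qed

text \<open>Multiplying by \<open>t\<close> cancels the denominator, so \<open>theta\<close>
  differentiates \<open>lap \<nu> k (1 / t)\<close>. The minus sign of the Laplace derivative
  cancels that of the derivative of \<open>1 / t\<close>, and the outer \<open>t\<close> leaves
  \<open>1 / t\<close>.\<close>

lemma theta_iterate:
  assumes nu: "- 1 < \<nu>" and t: "0 < t"
  shows "(theta ^^ k) (\<lambda>s. s powr \<nu> * exp s * inc_Gamma (- \<nu>) s) t = lap \<nu> k (1 / t) / (Gamma (1 + \<nu>) * t)"
  using t
proof (induction k arbitrary: t)
  case 0
  then show ?case using lap_0_eq[OF nu] by simp
next
  case (Suc k)
  let ?f = "(theta ^^ k) (\<lambda>s. s powr \<nu> * exp s * inc_Gamma (- \<nu>) s)"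
  \<comment> \<open>\<open>deriv\<close> looks at a neighbourhood, so the induction hypothesis is
    used at all nearby positive points.\<close>
  have "\<forall>\<^sub>F s in nhds t. s \<in> {0<..}"
    using Suc.prems by (intro eventually_nhds_in_open) auto
  then have ev: "\<forall>\<^sub>F s in nhds t. s * ?f s = lap \<nu> k (1 / s) / Gamma (1 + \<nu>)"
    by eventually_elim (simp add: Suc.IH)
  have "((\<lambda>s. lap \<nu> k (1 / s)) has_real_derivative (- lap \<nu> (Suc k) (1 / t)) * (- 1 / t\<^sup>2)) (at t)"
    using Suc.prems
    by (intro DERIV_chain2[OF has_real_derivative_lap[OF nu]])
       (auto intro!: derivative_eq_intros simp: power2_eq_square)
  then have "((\<lambda>s. lap \<nu> k (1 / s) / Gamma (1 + \<nu>)) has_real_derivative lap \<nu> (Suc k) (1 / t) / t\<^sup>2 / Gamma (1 + \<nu>)) (at t)"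
    by (intro DERIV_cdivide) simp
  then have "deriv (\<lambda>s. s * ?f s) t = lap \<nu> (Suc k) (1 / t) / t\<^sup>2 / Gamma (1 + \<nu>)"
    using deriv_cong_ev[OF ev refl] by (simp add: DERIV_imp_deriv)
  moreover have "(theta ^^ Suc k) (\<lambda>s. s powr \<nu> * exp s * inc_Gamma (- \<nu>) s) t = t * deriv (\<lambda>s. s * ?f s) t"
    by (simp add: theta_def[of ?f])
  ultimately show ?case
    using Suc.prems by (simp add: power2_eq_square)
qed

section \<open>Moments of the weight and of the iterates of \<open>theta\<close>\<close>

text \<open>For \<open>\<nu> > - 1 / 2\<close> this is the integral of
  \<open>x ^ k * rho \<nu> x * rho (\<nu> + p) x\<close> in closed form; \<open>p = 0\<close> gives
  the moments of the squared weight.\<close>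

definition rho_moment :: "real \<Rightarrow> nat \<Rightarrow> nat \<Rightarrow> real" where
  "rho_moment \<nu> k p = fact k * Gamma (k + \<nu> + 1) * Gamma (k + (\<nu> + p) + 1) * Gamma (k + \<nu> + (\<nu> + p) + 1)
     / Gamma (2 * real k + \<nu> + (\<nu> + p) + 2)"

lemma nn_integral_rho_nn_rho_nn:
  assumes "- 1 / 2 < \<nu>"
  shows "(\<integral>\<^sup>+x. ennreal (x ^ k) * rho_nn \<nu> x * rho_nn (\<nu> + real p) x \<partial>lpos) = ennreal (rho_moment \<nu> k p)"
  unfolding rho_moment_def using assms by (intro nn_integral_power_rho_nn_rho_nn) auto

lemma rho_moment_pos: "- 1 / 2 < \<nu> \<Longrightarrow> 0 < rho_moment \<nu> k p"
  unfolding rho_moment_def by (intro divide_pos_pos mult_pos_pos Gamma_real_pos) auto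

lemma has_bochner_integral_rho_power:
  assumes "- 1 / 2 < \<nu>"
  shows "has_bochner_integral lpos (\<lambda>x. x ^ k * (rho \<nu> x)\<^sup>2) (rho_moment \<nu> k 0)"
proof (rule has_bochner_integral_nn_integral)
  show "(\<lambda>x. x ^ k * (rho \<nu> x)\<^sup>2) \<in> borel_measurable lpos"
    by (intro borel_measurable_times measurable_lpos borel_measurable_power rho_measurable) auto
  have "(\<integral>\<^sup>+x. ennreal (x ^ k * (rho \<nu> x)\<^sup>2) \<partial>lpos) = (\<integral>\<^sup>+x. ennreal (x ^ k) * rho_nn \<nu> x * rho_nn (\<nu> + real 0) x \<partial>lpos)"
    by (intro nn_integral_lpos_cong)
       (auto simp: rho_nn_eq ennreal_mult'[symmetric] power2_eq_square mult_ac)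
  then show "(\<integral>\<^sup>+x. ennreal (x ^ k * (rho \<nu> x)\<^sup>2) \<partial>lpos) = ennreal (rho_moment \<nu> k 0)"
    using nn_integral_rho_nn_rho_nn[OF assms, of k 0] by simp
qed (use rho_moment_pos[OF assms] in \<open>auto intro: less_imp_le\<close>)

text \<open>Once the iterate is a Laplace transform at \<open>1 / t\<close>, interchanging the
  integrals leaves \<open>t powr (\<nu> + p - 1) * exp (- t - x / t)\<close> inside, which
  integrates to the weight of index \<open>\<nu> + p\<close>.\<close>

lemma has_bochner_integral_theta:
  assumes nu: "- 1 / 2 < \<nu>"
  shows "has_bochner_integral lpos
    (\<lambda>t. t ^ p * (t powr \<nu> * exp (- t) * (theta ^^ k) (\<lambda>s. s powr \<nu> * exp s * inc_Gamma (- \<nu>) s) t))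
    (rho_moment \<nu> k p / Gamma (1 + \<nu>))"
proof -
  have nu': "- 1 < \<nu>" using nu by simp
  have G: "0 < Gamma (1 + \<nu>)" using nu by (simp add: Gamma_real_pos)
  let ?\<Phi> = "\<lambda>t. \<integral>\<^sup>+x. ennreal (x ^ k * exp (- (1 / t) * x)) * rho_nn \<nu> x \<partial>lpos"
  let ?h = "\<lambda>t. t powr (\<nu> + p - 1) * exp (- t) * lap \<nu> k (1 / t)"
  have \<Phi>: "?\<Phi> t = ennreal (lap \<nu> k (1 / t))" "0 \<le> lap \<nu> k (1 / t)" if "0 < t" for t
    using that integral_lap(2,3)[OF nu', of "1 / t" k] by auto
  have "has_bochner_integral lpos ?h (rho_moment \<nu> k p)"
  proof (rule has_bochner_integral_nn_integral)
    \<comment> \<open>Measurability of \<open>lap\<close> in \<open>1 / t\<close> comes from its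
      nonnegative integral form.\<close>
    have "(\<lambda>t. t powr (\<nu> + p - 1) * exp (- t) * enn2real (?\<Phi> t)) \<in> borel_measurable lpos"
      by (rule measurable_lpos) measurable
    then show "?h \<in> borel_measurable lpos"
      by (subst measurable_cong[where g="\<lambda>t. t powr (\<nu> + p - 1) * exp (- t) * enn2real (?\<Phi> t)"])
         (use \<Phi> in auto)
    have "(\<integral>\<^sup>+t. ennreal (?h t) \<partial>lpos) = (\<integral>\<^sup>+t. ennreal (t powr (\<nu> + p - 1) * exp (- t)) * ?\<Phi> t \<partial>lpos)"
      by (intro nn_integral_lpos_cong) (simp only: \<Phi> ennreal_mult' ennreal_mult''[OF \<Phi>(2)])
    also have "\<dots> = (\<integral>\<^sup>+t. \<integral>\<^sup>+x. ennreal (t powr (\<nu> + p - 1) * exp (- t)) * (ennreal (x ^ k * exp (- (1 / t) * x)) * rho_nn \<nu> x) \<partial>lpos \<partial>lpos)"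
      by (intro nn_integral_lpos_cong nn_integral_cmult[symmetric] measurable_lpos) measurable
    also have "\<dots> = (\<integral>\<^sup>+x. \<integral>\<^sup>+t. ennreal (t powr (\<nu> + p - 1) * exp (- t)) * (ennreal (x ^ k * exp (- (1 / t) * x)) * rho_nn \<nu> x) \<partial>lpos \<partial>lpos)"
      by (rule tonelli_lpos) measurable
    also have "\<dots> = (\<integral>\<^sup>+x. ennreal (x ^ k) * rho_nn \<nu> x * rho_nn (\<nu> + real p) x \<partial>lpos)"
    proof (intro nn_integral_lpos_cong)
      fix x :: real assume x: "0 < x"
      have "(\<integral>\<^sup>+t. ennreal (t powr (\<nu> + p - 1) * exp (- t)) * (ennreal (x ^ k * exp (- (1 / t) * x)) * rho_nn \<nu> x) \<partial>lpos)
        = (\<integral>\<^sup>+t. ennreal (x ^ k) * rho_nn \<nu> x * ennreal (t powr (\<nu> + p - 1) * exp (- t - x / t)) \<partial>lpos)"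
      proof (intro nn_integral_lpos_cong)
        fix t :: real
        have "t powr (\<nu> + p - 1) * exp (- t) * (x ^ k * exp (- (1 / t) * x)) = x ^ k * (t powr (\<nu> + p - 1) * exp (- t - x / t))"
          by (simp add: exp_diff exp_minus divide_inverse)
        then have "ennreal (t powr (\<nu> + p - 1) * exp (- t)) * ennreal (x ^ k * exp (- (1 / t) * x)) = ennreal (x ^ k) * ennreal (t powr (\<nu> + p - 1) * exp (- t - x / t))"
          using x by (subst (1 2) ennreal_mult[symmetric]) auto
        then show "ennreal (t powr (\<nu> + p - 1) * exp (- t)) * (ennreal (x ^ k * exp (- (1 / t) * x)) * rho_nn \<nu> x)
            = ennreal (x ^ k) * rho_nn \<nu> x * ennreal (t powr (\<nu> + p - 1) * exp (- t - x / t))"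
          by (metis mult.assoc mult.commute)
      qed
      also have "\<dots> = ennreal (x ^ k) * rho_nn \<nu> x * rho_nn (\<nu> + real p) x"
        unfolding rho_nn_def[of "\<nu> + real p"] by (rule nn_integral_cmult, rule measurable_lpos) measurable
      finally show "(\<integral>\<^sup>+t. ennreal (t powr (\<nu> + p - 1) * exp (- t)) * (ennreal (x ^ k * exp (- (1 / t) * x)) * rho_nn \<nu> x) \<partial>lpos) = \<dots>" .
    qed
    finally show "(\<integral>\<^sup>+t. ennreal (?h t) \<partial>lpos) = ennreal (rho_moment \<nu> k p)"
      using nn_integral_rho_nn_rho_nn[OF nu] by simp
  qed (use \<Phi> rho_moment_pos[OF nu] in \<open>auto intro: less_imp_le\<close>)
  then have "has_bochner_integral lpos (\<lambda>t. ?h t / Gamma (1 + \<nu>)) (rho_moment \<nu> k p / Gamma (1 + \<nu>))"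
    by (rule has_bochner_integral_divide_zero)
  moreover have "t ^ p * (t powr \<nu> * exp (- t) * (theta ^^ k) (\<lambda>s. s powr \<nu> * exp s * inc_Gamma (- \<nu>) s) t)
      = ?h t / Gamma (1 + \<nu>)" if "t \<in> space lpos" for t
    using that G unfolding theta_iterate[OF nu' that[simplified]]
    by (simp add: powr_diff powr_add powr_realpow field_simps)
  ultimately show ?thesis
    by (subst has_bochner_integral_cong[OF refl _ refl]) auto
qed

section \<open>Linear functionals on polynomials\<close>

text \<open>The moment functional sending the \<open>i\<close>-th power to \<open>s i\<close>.
  Orthogonality arguments thereby become algebra for several weights at once, and
  \<open>has_bochner_integral_lin\<close> translates back to integrals.\<close>

definition lin :: "(nat \<Rightarrow> real) \<Rightarrow> real poly \<Rightarrow> real" where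
  "lin s q = (\<Sum>i\<le>degree q. coeff q i * s i)"

lemma lin_eq_sum:
  assumes "degree q \<le> N"
  shows "lin s q = (\<Sum>i\<le>N. coeff q i * s i)"
  unfolding lin_def using assms
  by (intro sum.mono_neutral_left) (auto simp: coeff_eq_0)

lemma lin_0 [simp]: "lin s 0 = 0"
  by (simp add: lin_def)

lemma lin_add: "lin s (p + q) = lin s p + lin s q"
proof -
  let ?N = "max (degree p) (degree q)"
  show ?thesis
    by (subst (1 2 3) lin_eq_sum[of _ ?N])
       (auto simp: degree_add_le sum.distrib algebra_simps)
qed

lemma lin_smult: "lin s (Polynomial.smult c q) = c * lin s q"
  by (subst (1 2) lin_eq_sum[of _ "degree q"]) (auto simp: sum_distrib_left mult_ac)

lemma lin_diff: "lin s (p - q) = lin s p - lin s q"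
  using lin_add[of s p "Polynomial.smult (- 1) q"] lin_smult[of s "- 1" q] by simp

lemma lin_sum: "lin s (\<Sum>i\<in>A. q i) = (\<Sum>i\<in>A. lin s (q i))"
  by (induction A rule: infinite_finite_induct) (auto simp: lin_add)

lemma lin_monom_mult: "lin s (monom c m * q) = c * (\<Sum>i\<le>degree q. coeff q i * s (m + i))"
proof -
  have "degree (monom c m * q) \<le> m + degree q"
    by (rule order_trans[OF degree_mult_le]) (simp add: degree_monom_le)
  then have "lin s (monom c m * q) = (\<Sum>i\<le>m + degree q. coeff (monom c m * q) i * s i)"
    by (rule lin_eq_sum)
  also have "\<dots> = (\<Sum>i\<in>{m..m + degree q}. c * (coeff q (i - m) * s i))"
    by (intro sum.mono_neutral_cong_right) (auto simp: coeff_monom_mult)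
  also have "\<dots> = (\<Sum>i\<le>degree q. c * (coeff q i * s (m + i)))"
    by (intro sum.reindex_bij_witness[of _ "\<lambda>i. m + i" "\<lambda>i. i - m"]) auto
  finally show ?thesis by (simp add: sum_distrib_left)
qed

lemma lin_mult:
  assumes "degree p \<le> N"
  shows "lin s (p * q) = (\<Sum>j\<le>N. coeff p j * lin s (monom 1 j * q))"
proof -
  have "p * q = (\<Sum>j\<le>N. monom (coeff p j) j) * q"
    using assms by (simp add: poly_as_sum_of_monoms')
  also have "\<dots> = (\<Sum>j\<le>N. Polynomial.smult (coeff p j) (monom 1 j * q))"
    by (simp add: sum_distrib_right smult_monom flip: mult_smult_left)
  finally show ?thesis by (simp add: lin_sum lin_smult)
qed

lemma has_bochner_integral_lin:
  assumes "\<And>i. has_bochner_integral M (\<lambda>x. x ^ i * w x) (s i)"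
  shows "has_bochner_integral M (\<lambda>x. poly q x * w x) (lin s q)"
proof -
  have "has_bochner_integral M (\<lambda>x. \<Sum>i\<le>degree q. coeff q i * (x ^ i * w x)) (lin s q)"
    unfolding lin_def
    by (intro has_bochner_integral_sum has_bochner_integral_mult_right assms)
  then show ?thesis
    by (simp add: poly_altdef sum_distrib_right mult.assoc)
qed

lemma graded_basis_expansion:
  fixes b :: "nat \<Rightarrow> real poly"
  assumes deg: "\<And>n. degree (b n) = n" and nz: "\<And>n. coeff (b n) n \<noteq> 0"
    and q: "degree q \<le> N"
  shows "\<exists>c. q = (\<Sum>r\<le>N. Polynomial.smult (c r) (b r))"
  using q
proof (induction N arbitrary: q)
  case 0
  then have "q = Polynomial.smult (coeff q 0 / coeff (b 0) 0) (b 0)"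
    using deg[of 0] nz[of 0] by (intro poly_eqI) (auto simp: coeff_eq_0 gr0_conv_Suc elim!: degree_eq_zeroE simp: coeff_pCons split: nat.splits)
  then show ?case by (intro exI[of _ "\<lambda>_. coeff q 0 / coeff (b 0) 0"]) simp
next
  case (Suc N)
  \<comment> \<open>This multiple of the top basis element cancels the leading term of
    \<open>q\<close>.\<close>
  define e where "e = coeff q (Suc N) / coeff (b (Suc N)) (Suc N)"
  have "degree (q - Polynomial.smult e (b (Suc N))) \<le> N"
  proof (rule degree_le, intro allI impI)
    fix i assume "N < i"
    then consider "i = Suc N" | "Suc N < i" by linarith
    then show "coeff (q - Polynomial.smult e (b (Suc N))) i = 0"
      using Suc.prems deg[of "Suc N"] nz[of "Suc N"] by cases (auto simp: e_def coeff_eq_0)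
  qed
  from Suc.IH[OF this] obtain c where "q - Polynomial.smult e (b (Suc N)) = (\<Sum>r\<le>N. Polynomial.smult (c r) (b r))" ..
  then have "q = (\<Sum>r\<le>Suc N. Polynomial.smult ((c(Suc N := e)) r) (b r))"
    by (simp add: algebra_simps)
  then show ?case by blast
qed

section \<open>Laguerre polynomials\<close>

text \<open>Laguerre coefficients, extended by zero above the degree so that the recurrence in
  \<open>m\<close> also holds at \<open>i = Suc m\<close>.\<close>

definition lagc :: "real \<Rightarrow> nat \<Rightarrow> nat \<Rightarrow> real" where
  "lagc \<nu> m i = (if i \<le> m then (- 1) ^ i * ((\<nu> + real m) gchoose (m - i)) / fact i else 0)"

text \<open>The constant coefficient is the absorption identity; the others combine Pascal's rule
  with \<open>gbinomial_mult_1\<close>, and at \<open>i = Suc m\<close> only the shifted coefficient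
  contributes.\<close>

lemma lagc_Suc:
  assumes "i \<le> Suc m"
  shows "(real m + 1) * lagc \<nu> (Suc m) i
    = (\<nu> + m + i + 1) * lagc \<nu> m i - (case i of 0 \<Rightarrow> 0 | Suc j \<Rightarrow> lagc \<nu> m j)"
proof (cases i)
  case 0
  have "real (Suc m) * ((\<nu> + real (Suc m)) gchoose Suc m) = (\<nu> + real (Suc m)) * ((\<nu> + real (Suc m) - 1) gchoose m)"
    by (rule gbinomial_absorption)
  then show ?thesis using 0 by (simp add: lagc_def algebra_simps)
next
  case (Suc j)
  show ?thesis
  proof (cases "j = m")
    case True
    then show ?thesis using Suc by (simp add: lagc_def divide_simps)
  next
    case False
    then obtain r where r: "m = Suc (j + r)"
      using assms Suc less_imp_Suc_add by (metis Suc_le_mono le_neq_implies_less)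
    let ?a = "\<nu> + real m"
    have 1: "(?a + 1) gchoose Suc r = (?a gchoose r) + (?a gchoose Suc r)"
      by (rule gbinomial_Suc_Suc)
    have 2: "?a * (?a gchoose r) = real r * (?a gchoose r) + real (Suc r) * (?a gchoose Suc r)"
      by (rule gbinomial_mult_1)
    define E :: real where "E = (- 1) ^ i / fact i"
    have l: "lagc \<nu> (Suc m) i = E * ((?a + 1) gchoose Suc r)" "lagc \<nu> m i = E * (?a gchoose r)"
      using Suc r by (auto simp: E_def lagc_def algebra_simps Suc_diff_le)
    have "lagc \<nu> m j = (- 1) ^ j * (?a gchoose Suc r) / fact j"
      using Suc r by (auto simp: lagc_def algebra_simps Suc_diff_le)
    also have "\<dots> = - (real i * (E * (?a gchoose Suc r)))"
      using Suc by (simp add: E_def del: of_nat_Suc)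
    finally have lj: "lagc \<nu> m j = - (real i * (E * (?a gchoose Suc r)))" .
    have "(real m + 1) * ((?a gchoose r) + (?a gchoose Suc r)) = (\<nu> + m + i + 1) * (?a gchoose r) + real i * (?a gchoose Suc r)"
      using 2 Suc r by (simp add: algebra_simps)
    then have "E * ((real m + 1) * ((?a + 1) gchoose Suc r))
      = E * ((\<nu> + m + i + 1) * (?a gchoose r) + real i * (?a gchoose Suc r))"
      unfolding 1 by (rule arg_cong)
    moreover have "(case i of 0 \<Rightarrow> 0 | Suc j \<Rightarrow> lagc \<nu> m j) = - (real i * (E * (?a gchoose Suc r)))"
      using Suc lj by simp
    ultimately show ?thesis
      unfolding l by (simp add: algebra_simps)
  qed
qed

text \<open>The coefficients of \<open>(m + 1) L\<^sub>m\<^sub>+\<^sub>1 = (\<nu> + m + 1 - t) L\<^sub>m + t L\<^sub>m'\<close>, paired with a sequence.\<close>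

lemma sum_lagc_Suc:
  "(real m + 1) * (\<Sum>i\<le>Suc m. lagc \<nu> (Suc m) i * s i)
     = (\<Sum>i\<le>m. lagc \<nu> m i * ((\<nu> + m + i + 1) * s i - s (Suc i)))"
proof -
  have "(real m + 1) * (\<Sum>i\<le>Suc m. lagc \<nu> (Suc m) i * s i)
    = (\<Sum>i\<le>Suc m. ((\<nu> + m + i + 1) * lagc \<nu> m i - (case i of 0 \<Rightarrow> 0 | Suc j \<Rightarrow> lagc \<nu> m j)) * s i)"
    unfolding sum_distrib_left by (intro sum.cong refl) (simp add: lagc_Suc[symmetric])
  also have "\<dots> = (\<Sum>i\<le>Suc m. (\<nu> + m + i + 1) * lagc \<nu> m i * s i) - (\<Sum>i\<le>Suc m. (case i of 0 \<Rightarrow> 0 | Suc j \<Rightarrow> lagc \<nu> m j) * s i)"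
    by (simp add: left_diff_distrib sum_subtractf)
  also have "(\<Sum>i\<le>Suc m. (\<nu> + m + i + 1) * lagc \<nu> m i * s i) = (\<Sum>i\<le>m. (\<nu> + m + i + 1) * lagc \<nu> m i * s i)"
    by (simp add: lagc_def)
  also have "(\<Sum>i\<le>Suc m. (case i of 0 \<Rightarrow> 0 | Suc j \<Rightarrow> lagc \<nu> m j) * s i) = (\<Sum>i\<le>m. lagc \<nu> m i * s (Suc i))"
    by (subst sum.atMost_Suc_shift) simp
  finally show ?thesis by (simp add: sum_subtractf[symmetric] algebra_simps)
qed

text \<open>The sum is the integral of \<open>t powr (\<nu> + j) * exp (- t)\<close> against the
  Laguerre polynomial. By the functional equation of Gamma each step of the recurrence contributes
  the factor \<open>m - j\<close>, independent of \<open>i\<close>, so the sum vanishes for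
  \<open>j < m\<close>.\<close>

lemma sum_lagc_Gamma:
  assumes nu: "- 1 < \<nu>"
  shows "(\<Sum>i\<le>m. lagc \<nu> m i * Gamma (\<nu> + 1 + real (j + i)))
    = (- 1) ^ m * (real j gchoose m) * Gamma (\<nu> + 1 + j)"
proof (induction m)
  case 0
  then show ?case by (simp add: lagc_def)
next
  case (Suc m)
  have "(real m + 1) * (\<Sum>i\<le>Suc m. lagc \<nu> (Suc m) i * Gamma (\<nu> + 1 + real (j + i)))
    = (\<Sum>i\<le>m. lagc \<nu> m i * ((\<nu> + m + i + 1) * Gamma (\<nu> + 1 + real (j + i)) - Gamma (\<nu> + 1 + real (j + Suc i))))"
    by (rule sum_lagc_Suc)
  also have "\<dots> = (\<Sum>i\<le>m. (real m - real j) * (lagc \<nu> m i * Gamma (\<nu> + 1 + real (j + i))))"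
  proof (intro sum.cong refl)
    fix i
    have "\<nu> + 1 + real (j + i) \<notin> \<int>\<^sub>\<le>\<^sub>0" using nu by (auto dest: nonpos_Ints_nonpos)
    then have "Gamma (\<nu> + 1 + real (j + Suc i)) = (\<nu> + 1 + real (j + i)) * Gamma (\<nu> + 1 + real (j + i))"
      using Gamma_plus1[of "\<nu> + 1 + real (j + i)"] by (simp add: add_ac)
    then show "lagc \<nu> m i * ((\<nu> + m + i + 1) * Gamma (\<nu> + 1 + real (j + i)) - Gamma (\<nu> + 1 + real (j + Suc i)))
      = (real m - real j) * (lagc \<nu> m i * Gamma (\<nu> + 1 + real (j + i)))"
      by (simp add: algebra_simps)
  qed
  also have "\<dots> = (real m - real j) * ((- 1) ^ m * (real j gchoose m) * Gamma (\<nu> + 1 + j))"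
    by (simp only: sum_distrib_left[symmetric] Suc.IH)
  also have "\<dots> = (real m + 1) * ((- 1) ^ Suc m * (real j gchoose Suc m) * Gamma (\<nu> + 1 + j))"
  proof -
    have "real j * (real j gchoose m) = real m * (real j gchoose m) + real (Suc m) * (real j gchoose Suc m)"
      by (rule gbinomial_mult_1)
    then have "(real m - real j) * (real j gchoose m) = - ((real m + 1) * (real j gchoose Suc m))"
      by (simp add: algebra_simps)
    then have "(- 1) ^ m * Gamma (\<nu> + 1 + j) * ((real m - real j) * (real j gchoose m)) = (- 1) ^ m * Gamma (\<nu> + 1 + j) * - ((real m + 1) * (real j gchoose Suc m))"
      by (rule arg_cong)
    then show ?thesis by (simp add: algebra_simps)
  qed
  finally show ?case
    by (subst (asm) mult_left_cancel) auto
qed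

text \<open>The moment form of \<open>x * rho \<mu> x = rho (\<mu> + 2) x - (\<mu> + 1) * rho (\<mu>
  + 1) x\<close> at \<open>\<mu> = \<nu> + p\<close>. After extracting common Gamma factors it is
  the polynomial identity \<open>(k + 1) * a = b * c - (\<nu> + p + 1) * d\<close>.\<close>

lemma rho_moment_Suc:
  assumes nu: "- 1 / 2 < \<nu>"
  shows "rho_moment \<nu> (Suc k) p = rho_moment \<nu> k (p + 2) - (\<nu> + p + 1) * rho_moment \<nu> k (p + 1)"
proof -
  have G: "Gamma (x + 1) = x * Gamma x" if "0 < x" for x :: real
    using that by (intro Gamma_plus1) (auto dest: nonpos_Ints_nonpos)
  define a b c d where "a = k + \<nu> + 1" and "b = k + \<nu> + p + 2" and "c = k + 2 * \<nu> + p + 2" and "d = 2 * k + 2 * \<nu> + p + 3"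
  have pos: "0 < a" "0 < b" "0 < c" "0 < d" using nu by (auto simp: a_def b_def c_def d_def)
  have Weq: "rho_moment \<nu> (Suc k) p = fact k * (k + 1) * Gamma (a + 1) * Gamma b * Gamma c / Gamma (d + 1)"
    "rho_moment \<nu> k (p + 1) = fact k * Gamma a * Gamma b * Gamma c / Gamma d"
    "rho_moment \<nu> k (p + 2) = fact k * Gamma a * Gamma (b + 1) * Gamma (c + 1) / Gamma (d + 1)"
    by (simp_all add: rho_moment_def a_def b_def c_def d_def algebra_simps)
  note Weq = Weq[unfolded G[OF pos(1)] G[OF pos(2)] G[OF pos(3)] G[OF pos(4)]]
  have "(k + 1) * a = b * c - (\<nu> + p + 1) * d"
    by (simp add: a_def b_def c_def d_def algebra_simps)
  then have "fact k * Gamma a * Gamma b * Gamma c / (d * Gamma d) * ((k + 1) * a)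
     = fact k * Gamma a * Gamma b * Gamma c / (d * Gamma d) * (b * c - (\<nu> + p + 1) * d)"
    by (rule arg_cong)
  then show ?thesis
    unfolding Weq using pos less_imp_neq[OF Gamma_real_pos[OF pos(4)]] by (simp add: field_simps)
qed

text \<open>By \<open>rho_moment_Suc\<close> each Laguerre step trades index shifts of the second
  weight for one more power of \<open>x\<close> and a minus sign; hence the induction is over all
  \<open>k\<close>.\<close>

lemma sum_lagc_rho_moment:
  assumes nu: "- 1 / 2 < \<nu>"
  shows "(\<Sum>i\<le>m. lagc \<nu> m i * rho_moment \<nu> k (m + i)) = (- 1) ^ m / fact m * rho_moment \<nu> (k + m) 0"
proof (induction m arbitrary: k)
  case 0
  then show ?case by (simp add: lagc_def)
next
  case (Suc m)
  have "(real m + 1) * (\<Sum>i\<le>Suc m. lagc \<nu> (Suc m) i * rho_moment \<nu> k (Suc m + i))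
    = (\<Sum>i\<le>m. lagc \<nu> m i * ((\<nu> + m + i + 1) * rho_moment \<nu> k (Suc m + i) - rho_moment \<nu> k (Suc m + Suc i)))"
    by (rule sum_lagc_Suc)
  also have "\<dots> = (\<Sum>i\<le>m. - (lagc \<nu> m i * rho_moment \<nu> (Suc k) (m + i)))"
    by (intro sum.cong refl) (simp add: rho_moment_Suc[OF nu] algebra_simps)
  also have "\<dots> = - ((- 1) ^ m / fact m * rho_moment \<nu> (Suc k + m) 0)"
    by (simp only: sum_negf Suc.IH)
  also have "\<dots> = (real m + 1) * ((- 1) ^ Suc m / fact (Suc m) * rho_moment \<nu> (k + Suc m) 0)"
  proof -
    have "fact (Suc m) = (real m + 1) * fact m" "real m + 1 \<noteq> 0"
      by (simp_all add: algebra_simps)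
    then show ?thesis by (simp del: fact_Suc)
  qed
  finally show ?case
    by (subst (asm) mult_left_cancel) auto
qed

definition lagp :: "real \<Rightarrow> nat \<Rightarrow> real poly" where
  "lagp \<nu> m = (\<Sum>i\<le>m. monom (lagc \<nu> m i) i)"

lemma coeff_lagp: "coeff (lagp \<nu> m) i = lagc \<nu> m i"
  unfolding lagp_def by (simp add: coeff_sum lagc_def)

lemma coeff_lagp_lead: "coeff (lagp \<nu> m) m = (- 1) ^ m / fact m"
  by (simp add: coeff_lagp lagc_def)

lemma degree_lagp: "degree (lagp \<nu> m) = m"
  by (intro antisym degree_le le_degree) (auto simp: coeff_lagp lagc_def)

lemma poly_lagp: "poly (lagp \<nu> m) t = laguerre m \<nu> t"
  unfolding lagp_def laguerre_def by (simp add: poly_sum poly_monom lagc_def)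

lemma has_bochner_integral_lin_Gamma:
  assumes nu: "- 1 < \<nu>"
  shows "has_bochner_integral lpos (\<lambda>t. poly q t * (t powr \<nu> * exp (- t))) (lin (\<lambda>i. Gamma (\<nu> + 1 + real i)) q)"
proof (rule has_bochner_integral_lin, rule has_bochner_integral_nn_integral)
  fix i :: nat
  show "(\<lambda>t. t ^ i * (t powr \<nu> * exp (- t))) \<in> borel_measurable lpos"
    by (rule measurable_lpos) measurable
  have "(\<integral>\<^sup>+t. ennreal (t ^ i * (t powr \<nu> * exp (- t))) \<partial>lpos) = (\<integral>\<^sup>+t. ennreal (t powr (\<nu> + 1 + real i - 1) * exp (- 1 * t)) \<partial>lpos)"
    by (intro nn_integral_lpos_cong) (simp add: powr_add powr_realpow mult_ac)
  also have "\<dots> = ennreal (Gamma (\<nu> + 1 + real i))"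
    using nu by (subst nn_integral_Gamma) auto
  finally show "(\<integral>\<^sup>+t. ennreal (t ^ i * (t powr \<nu> * exp (- t))) \<partial>lpos) = ennreal (Gamma (\<nu> + 1 + real i))" .
qed (use nu in \<open>auto intro!: less_imp_le[OF Gamma_real_pos]\<close>)

text \<open>Among the powers up to \<open>m\<close> only the top one survives, because
  \<open>j gchoose m\<close> vanishes for \<open>j < m\<close>.\<close>

lemma lin_Gamma_lagp:
  assumes nu: "- 1 < \<nu>" and q: "degree q \<le> m"
  shows "lin (\<lambda>i. Gamma (\<nu> + 1 + real i)) (q * lagp \<nu> m) = (- 1) ^ m * coeff q m * Gamma (\<nu> + 1 + m)"
proof -
  have "lin (\<lambda>i. Gamma (\<nu> + 1 + real i)) (monom 1 j * lagp \<nu> m)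
      = (if j = m then (- 1) ^ m * Gamma (\<nu> + 1 + m) else 0)" if "j \<le> m" for j
  proof -
    have "(real j gchoose m) = (if j = m then 1 else 0)"
      using that by (simp add: binomial_gbinomial[symmetric] binomial_eq_0)
    then show ?thesis
      using sum_lagc_Gamma[OF nu, of m j] by (simp add: lin_monom_mult degree_lagp coeff_lagp)
  qed
  then have "lin (\<lambda>i. Gamma (\<nu> + 1 + real i)) (q * lagp \<nu> m)
     = (\<Sum>j\<le>m. coeff q j * (if j = m then (- 1) ^ m * Gamma (\<nu> + 1 + m) else 0))"
    unfolding lin_mult[OF q] by (intro sum.cong) auto
  then show ?thesis by (simp add: if_distrib sum.delta mult_ac cong: if_cong)
qed

lemma lin_Gamma_lagp_lagp:
  assumes nu: "- 1 < \<nu>"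
  shows "lin (\<lambda>i. Gamma (\<nu> + 1 + real i)) (lagp \<nu> r * lagp \<nu> m) = (if r = m then Gamma (\<nu> + 1 + m) / fact m else 0)"
proof (cases "r \<le> m")
  case True
  then show ?thesis
    using lin_Gamma_lagp[OF nu, of "lagp \<nu> r" m] coeff_lagp_lead[of \<nu> m]
    by (auto simp: degree_lagp coeff_eq_0 power_add[symmetric] simp flip: mult.assoc)
next
  case False
  then show ?thesis
    using lin_Gamma_lagp[OF nu, of "lagp \<nu> m" r]
    by (auto simp: degree_lagp coeff_eq_0 mult.commute[of "lagp \<nu> r"])
qed

section \<open>Evaluation of the matrix entries\<close>

text \<open>\<open>d_coef\<close> yields the Laguerre coefficients of \<open>T\<close> times the
  squared norms, and the prefactor of \<open>c_coef\<close> divides by those norms. The sum is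
  therefore the functional \<open>\<Psi>\<close> applied to \<open>T\<close>, finite because
  \<open>T\<close> has degree at most \<open>2 * m\<close>.\<close>

lemma f_coef_eq:
  assumes nu: "- 1 / 2 < \<nu>"
  shows "f_coef \<nu> k m = (- 1) ^ m / (fact m * Gamma (1 + \<nu>)) * rho_moment \<nu> (k + m) 0"
proof -
  have nu': "- 1 < \<nu>" using nu by simp
  define \<Lambda> where "\<Lambda> = lin (\<lambda>i. Gamma (\<nu> + 1 + real i))"
  define \<Psi> where "\<Psi> = lin (\<lambda>i. rho_moment \<nu> k i / Gamma (1 + \<nu>))"
  define T where "T = monom 1 m * lagp \<nu> m"
  have c: "c_coef \<nu> k r = fact r / Gamma (1 + \<nu> + real r) * \<Psi> (lagp \<nu> r)" for r
    using has_bochner_integral_integral_eq[OF has_bochner_integral_lin[OF has_bochner_integral_theta[OF nu], where q="lagp \<nu> r"]]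
    unfolding c_coef_def \<Psi>_def set_lebesgue_integral_lpos poly_lagp by (simp add: mult_ac)
  have d: "d_coef \<nu> m r = \<Lambda> (T * lagp \<nu> r)" for r
  proof -
    have "d_coef \<nu> m r = (\<integral>t. poly (T * lagp \<nu> r) t * (t powr \<nu> * exp (- t)) \<partial>lpos)"
      unfolding d_coef_def set_lebesgue_integral_lpos T_def
      by (intro Bochner_Integration.integral_cong)
         (auto simp: poly_monom poly_lagp powr_add powr_realpow mult_ac)
    then show ?thesis
      using has_bochner_integral_integral_eq[OF has_bochner_integral_lin_Gamma[OF nu']]
      unfolding \<Lambda>_def by (simp only:)
  qed
  have "degree T \<le> 2 * m"
    unfolding T_def by (rule order_trans[OF degree_mult_le]) (simp add: degree_monom_eq degree_lagp)
  then obtain e where e: "T = (\<Sum>r\<le>2 * m. Polynomial.smult (e r) (lagp \<nu> r))"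
    using graded_basis_expansion[of "lagp \<nu>" T "2 * m"] by (auto simp: degree_lagp coeff_lagp_lead)
  have "\<Lambda> (T * lagp \<nu> r) = e r * (Gamma (\<nu> + 1 + real r) / fact r)" if "r \<le> 2 * m" for r
  proof -
    have "\<Lambda> (T * lagp \<nu> r) = (\<Sum>s\<le>2 * m. e s * \<Lambda> (lagp \<nu> s * lagp \<nu> r))"
      unfolding e \<Lambda>_def by (simp add: sum_distrib_right lin_sum lin_smult)
    also have "\<dots> = (\<Sum>s\<le>2 * m. if s = r then e r * (Gamma (\<nu> + 1 + real r) / fact r) else 0)"
      unfolding \<Lambda>_def by (intro sum.cong) (auto simp: lin_Gamma_lagp_lagp[OF nu'])
    finally show ?thesis using that by simp
  qed
  then have "f_coef \<nu> k m = (\<Sum>r\<le>2 * m. \<Psi> (lagp \<nu> r) * e r)"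
    unfolding f_coef_def using nu
    by (intro sum.cong refl) (simp add: c d add_ac less_imp_neq[OF Gamma_real_pos, symmetric])
  also have "\<dots> = \<Psi> T"
    unfolding e \<Psi>_def by (simp add: lin_sum lin_smult mult_ac)
  also have "\<dots> = (\<Sum>i\<le>m. lagc \<nu> m i * rho_moment \<nu> k (m + i)) / Gamma (1 + \<nu>)"
    unfolding \<Psi>_def T_def by (simp add: lin_monom_mult degree_lagp coeff_lagp sum_divide_distrib)
  finally show ?thesis
    unfolding sum_lagc_rho_moment[OF nu] by simp
qed

section \<open>Orthonormal polynomials\<close>

text \<open>Legendre's duplication formula at \<open>z = j + \<nu> + 1\<close> splits the
  denominator \<open>Gamma (2 * z)\<close>; the remaining Gamma quotients are Pochhammer symbols.
  This is the constant and summand pattern of \<open>S\<close>.\<close>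

lemma rho_moment_0_eq:
  assumes nu: "- 1 / 2 < \<nu>"
  shows "rho_moment \<nu> j 0 = sqrt pi * (Gamma (1 + 2 * \<nu>) * Gamma (1 + \<nu>)) / (2 powr (1 + 2 * \<nu>) * Gamma (\<nu> + 3 / 2)) *
    (fact j * (pochhammer (1 + 2 * \<nu>) j * pochhammer (1 + \<nu>) j / (4 ^ j * pochhammer (\<nu> + 3 / 2) j)))"
proof -
  have pos: "0 < Gamma x" "Gamma x \<noteq> 0" "x \<notin> \<int>\<^sub>\<le>\<^sub>0" if "0 < x" for x :: real
  proof -
    show "0 < Gamma x" by (rule Gamma_real_pos[OF that])
    from less_imp_neq[OF this] show "Gamma x \<noteq> 0" by (rule not_sym)
    show "x \<notin> \<int>\<^sub>\<le>\<^sub>0" using that by (auto dest: nonpos_Ints_nonpos)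
  qed
  define z where "z = j + \<nu> + 1"
  have z: "0 < z" using nu by (simp add: z_def)
  have "Gamma z * Gamma (z + 1 / 2) = exp ((1 - 2 * z) * ln 2) * sqrt pi * Gamma (2 * z)"
  proof -
    \<comment> \<open>The duplication formula is applied to the complex image of \<open>z\<close>
      and pulled back by injectivity of \<open>of_real\<close>.\<close>
    have "complex_of_real z \<notin> \<int>\<^sub>\<le>\<^sub>0" "complex_of_real z + 1 / 2 \<notin> \<int>\<^sub>\<le>\<^sub>0"
      using pos(3)[OF z] pos(3)[of "z + 1 / 2"] z of_real_in_nonpos_Ints_iff[where 'a=complex, of z]
        of_real_in_nonpos_Ints_iff[where 'a=complex, of "z + 1 / 2"]
      by simp_all
    note G = Gamma_legendre_duplication[OF this]
    have e: "complex_of_real (exp ((1 - 2 * z) * ln 2)) = exp ((1 - 2 * complex_of_real z) * complex_of_real (ln 2))"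
      by (subst exp_of_real[symmetric]) simp
    from G
    have "complex_of_real (Gamma z * Gamma (z + 1 / 2))
        = complex_of_real (exp ((1 - 2 * z) * ln 2) * sqrt pi * Gamma (2 * z))"
      by (simp add: Gamma_complex_of_real[symmetric] e)
    then show ?thesis by (simp only: of_real_eq_iff)
  qed
  also have "exp ((1 - 2 * z) * ln 2) = 1 / (2 powr (1 + 2 * \<nu>) * 4 ^ j)"
  proof -
    have "(4::real) ^ j = 2 powr (2 * real j)"
      by (simp add: powr_realpow[symmetric] powr_powr[symmetric])
    then have "2 powr (1 + 2 * \<nu>) * 4 ^ j = 2 powr (2 * z - 1)"
      by (simp add: powr_add[symmetric] z_def algebra_simps)
    moreover have "exp ((1 - 2 * z) * ln 2) = 2 powr (- (2 * z - 1))"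
      by (simp add: powr_def)
    ultimately show ?thesis by (simp only: powr_minus divide_inverse mult_1)
  qed
  finally have e1: "Gamma (2 * z) = 2 powr (1 + 2 * \<nu>) * 4 ^ j * Gamma z * Gamma (z + 1 / 2) / sqrt pi"
    by (simp add: field_simps)
  have e2: "rho_moment \<nu> j 0 = fact j * Gamma z * Gamma z * Gamma (1 + 2 * \<nu> + j) / Gamma (2 * z)"
    by (simp add: rho_moment_def z_def algebra_simps)
  have e3: "pochhammer (1 + 2 * \<nu>) j = Gamma (1 + 2 * \<nu> + j) / Gamma (1 + 2 * \<nu>)"
    "pochhammer (1 + \<nu>) j = Gamma z / Gamma (1 + \<nu>)"
    "pochhammer (\<nu> + 3 / 2) j = Gamma (z + 1 / 2) / Gamma (\<nu> + 3 / 2)"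
    using nu pos by (simp_all add: pochhammer_Gamma z_def algebra_simps)
  \<comment> \<open>The Gamma values become variables, so that only a field identity with nonzero
    denominators remains.\<close>
  have alg: "f * gz * gz * g3 / (T * F * gz * gh / sp) = sp * (g1 * g2) / (T * g4) * (f * (g3 / g1 * (gz / g2) / (F * (gh / g4))))"
    if "gz \<noteq> 0" "gh \<noteq> 0" "g1 \<noteq> 0" "g2 \<noteq> 0" "g4 \<noteq> 0" "T \<noteq> 0" "F \<noteq> 0" "sp \<noteq> 0"
    for f gz gh g1 g2 g3 g4 T F sp :: real
    using that by (simp add: field_simps)
  show ?thesis
    unfolding e2 e1 e3 by (rule alg) (use z nu in \<open>auto intro!: pos(2)\<close>)
qed

lemma lin_monom: "lin s (monom c k) = c * s k"
  using lin_monom_mult[of s c k 1] by simp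

lemma lin_monom_mult_lessThan:
  "lin s (monom 1 m * (\<Sum>j<n. monom (v j) j)) = (\<Sum>j<n. v j * s (m + j))"
  by (simp add: sum_distrib_left mult_monom lin_sum lin_monom)

lemma f_mat_carrier [simp]: "f_mat \<nu> n \<in> carrier_mat n n"
  by (simp add: f_mat_def)

section \<open>The Hankel system, its determinant and Cramer's rule\<close>

context
  fixes \<nu> :: real and P :: "nat \<Rightarrow> real poly"
  assumes nu: "- 1 / 2 < \<nu>" and P: "orthonormal_polys (\<lambda>x. (rho \<nu> x)\<^sup>2) P"
begin

abbreviation "mom \<equiv> \<lambda>j. rho_moment \<nu> j 0"
abbreviation "c m \<equiv> (- 1) ^ m / (fact m * Gamma (1 + \<nu>))"

text \<open>Entry \<open>(m, j)\<close> is a row factor times the moment of order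
  \<open>m + 1 + j\<close>; applied to a coefficient vector, row \<open>m\<close> pairs the
  polynomial with the power \<open>Suc m\<close>.\<close>

lemma f_mat_mult_vec:
  assumes "m < n"
  shows "vec_index (f_mat \<nu> n *\<^sub>v Matrix.vec n v) m = c m * lin mom (monom 1 (Suc m) * (\<Sum>j<n. monom (v j) j))"
proof -
  have "vec_index (f_mat \<nu> n *\<^sub>v Matrix.vec n v) m = (\<Sum>j<n. f_coef \<nu> (j + 1) m * v j)"
    using assms by (simp add: f_mat_def scalar_prod_def atLeast0LessThan)
  also have "\<dots> = (\<Sum>j<n. c m * (v j * mom (Suc m + j)))"
    by (intro sum.cong refl) (simp add: f_coef_eq[OF nu] add_ac)
  finally show ?thesis
    by (simp only: lin_monom_mult_lessThan sum_distrib_left[symmetric])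
qed

lemma has_bochner_integral_poly_rho:
  "has_bochner_integral lpos (\<lambda>x. poly q x * (rho \<nu> x)\<^sup>2) (lin mom q)"
  by (intro has_bochner_integral_lin has_bochner_integral_rho_power[OF nu])

lemma degree_P: "degree (P n) = n"
  and lead_P: "0 < coeff (P n) n"
  using P by (auto simp: orthonormal_polys_def)

lemma lin_P_P: "lin mom (P m * P n) = (if m = n then 1 else 0)"
  using P has_bochner_integral_integral_eq[OF has_bochner_integral_poly_rho, of "P m * P n"]
  by (simp add: orthonormal_polys_def set_lebesgue_integral_lpos)

text \<open>Expanding \<open>q\<close> in the orthonormal system, the pairing selects the
  coefficient of \<open>P n\<close>, which the leading coefficients determine; it is zero below
  degree \<open>n\<close>.\<close>

lemma lin_mult_P:
  assumes "degree q \<le> n"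
  shows "lin mom (q * P n) = coeff q n / coeff (P n) n"
proof -
  obtain e where e: "q = (\<Sum>r\<le>n. Polynomial.smult (e r) (P r))"
    using graded_basis_expansion[of P q n] assms degree_P lead_P by (metis less_irrefl)
  have "coeff q n = (\<Sum>r\<le>n. e r * coeff (P r) n)"
    by (simp add: e coeff_sum)
  also have "\<dots> = (\<Sum>r\<le>n. if r = n then e n * coeff (P n) n else 0)"
    by (intro sum.cong refl) (auto simp: degree_P coeff_eq_0)
  finally have "coeff q n = e n * coeff (P n) n" by simp
  moreover have "lin mom (q * P n) = (\<Sum>r\<le>n. e r * lin mom (P r * P n))"
    by (simp add: e sum_distrib_right lin_sum lin_smult)
  then have "lin mom (q * P n) = (\<Sum>r\<le>n. if r = n then e n else 0)"
    by (simp add: lin_P_P if_distrib cong: if_cong)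
  ultimately show ?thesis
    using lead_P[of n] by simp
qed

lemma eq_0_if_orthogonal:
  assumes "lin mom (q * P (degree q)) = 0"
  shows "q = 0"
  using assms lin_mult_P[of q "degree q"] lead_P[of "degree q"] by simp

text \<open>A kernel vector of the matrix yields a polynomial \<open>q\<close> with \<open>\<integral>x q\<^sup>2 \<rho>\<^sup>2 = 0\<close>.\<close>

lemma D_nonzero: "D \<nu> n \<noteq> 0"
proof
  assume "D \<nu> n = 0"
  then obtain v where v: "v \<in> carrier_vec n" "v \<noteq> 0\<^sub>v n" "f_mat \<nu> n *\<^sub>v v = 0\<^sub>v n"
    unfolding D_def by (subst (asm) det_0_iff_vec_prod_zero[OF f_mat_carrier]) auto
  define q where "q = (\<Sum>j<n. monom (vec_index v j) j)"
  have v_eq: "v = Matrix.vec n (vec_index v)" using v(1) by auto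
  have coeff_q: "coeff q i = (if i < n then vec_index v i else 0)" for i
    by (simp add: q_def coeff_sum)
  have deg: "degree q \<le> n"
    by (intro degree_le) (auto simp: coeff_q)
  have "lin mom (monom 1 (Suc m) * q) = 0" if "m < n" for m
  proof -
    have "c m * lin mom (monom 1 (Suc m) * q) = vec_index (f_mat \<nu> n *\<^sub>v v) m"
      using f_mat_mult_vec[OF that, of "vec_index v"] v_eq by (simp add: q_def)
    then show ?thesis
      using v(3) that nu less_imp_neq[OF Gamma_real_pos[of "1 + \<nu>"]] by simp
  qed
  \<comment> \<open>For \<open>j < n\<close> the row equation applies; for larger \<open>j\<close>
    the coefficient is zero.\<close>
  then have "coeff q j * lin mom (monom 1 j * (monom 1 1 * q)) = 0" for j
    by (simp add: coeff_q mult_monom flip: mult.assoc)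
  then have "lin mom (q * (monom 1 1 * q)) = 0"
    unfolding lin_mult[OF deg] by (intro sum.neutral) blast
  then have hb: "has_bochner_integral lpos (\<lambda>x. x * (poly q x)\<^sup>2 * (rho \<nu> x)\<^sup>2) 0"
    using has_bochner_integral_poly_rho[of "q * (monom 1 1 * q)"]
    by (simp add: poly_monom power2_eq_square mult_ac)
  have "AE x in lpos. x * (poly q x)\<^sup>2 * (rho \<nu> x)\<^sup>2 = 0"
    using hb by (subst integral_nonneg_eq_0_iff_AE[symmetric]) (auto simp: has_bochner_integral_iff)
  \<comment> \<open>Almost everywhere \<open>q\<close> or the weight vanishes, and either one kills
    the pairing of \<open>q\<close> with \<open>P (degree q)\<close>, which detects its leading
    coefficient.\<close>
  then have "AE x in lpos. poly (q * P (degree q)) x * (rho \<nu> x)\<^sup>2 = 0"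
    using AE_space by eventually_elim auto
  then have "(\<integral>x. poly (q * P (degree q)) x * (rho \<nu> x)\<^sup>2 \<partial>lpos) = 0"
    by (intro integral_eq_zero_AE)
  then have "lin mom (q * P (degree q)) = 0"
    using has_bochner_integral_integral_eq[OF has_bochner_integral_poly_rho, of "q * P (degree q)"] by simp
  then have "q = 0" by (rule eq_0_if_orthogonal)
  then have "v = 0\<^sub>v n"
    using v(1) coeff_q by (intro eq_vecI) (auto, metis coeff_0)
  with v(2) show False by simp
qed

text \<open>Orthogonality of \<open>P n\<close> to the power \<open>m < n\<close>, with the constant
  term moved to the right: a linear system for the remaining coefficients.\<close>

lemma sum_coeff_P_mom:
  assumes "m < n"
  shows "lin mom (monom 1 (Suc m) * (\<Sum>j<n. monom (coeff (P n) (Suc j)) j)) = - coeff (P n) 0 * mom m"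
proof -
  have "0 = lin mom (monom 1 m * P n)"
    using lin_mult_P[of "monom 1 m" n] assms by (simp add: degree_monom_eq)
  also have "\<dots> = (\<Sum>k\<le>n. coeff (P n) k * mom (m + k))"
    by (simp add: lin_monom_mult degree_P)
  also have "\<dots> = coeff (P n) 0 * mom m + (\<Sum>j<n. coeff (P n) (Suc j) * mom (m + Suc j))"
    by (simp add: sum.atMost_shift)
  finally show ?thesis
    by (simp add: lin_monom_mult_lessThan)
qed

text \<open>With zero constant term the system is homogeneous, so nonsingularity would make all
  remaining coefficients, the leading one included, vanish.\<close>

lemma coeff_P_0_nonzero: "coeff (P n) 0 \<noteq> 0"
proof
  assume 0: "coeff (P n) 0 = 0"
  let ?v = "Matrix.vec n (\<lambda>j. coeff (P n) (Suc j))"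
  have "f_mat \<nu> n *\<^sub>v ?v = 0\<^sub>v n"
    using 0 by (intro eq_vecI) (auto simp: f_mat_mult_vec sum_coeff_P_mom, simp add: f_mat_def)
  then have "D \<nu> n = 0" if "?v \<noteq> 0\<^sub>v n"
    unfolding D_def det_0_iff_vec_prod_zero[OF f_mat_carrier]
    using that by (intro exI[of _ ?v]) auto
  then have "?v = 0\<^sub>v n"
    using D_nonzero[of n] by blast
  then have "coeff (P n) (Suc j) = 0" if "j < n" for j
    using that by (metis index_vec index_zero_vec(1))
  with 0 have "coeff (P n) n = 0" by (cases n) auto
  with lead_P[of n] show False by simp
qed

text \<open>Divided by minus the constant term, the orthogonality system has the moments from order
  0 on its right, which with the row factors is the column of \<open>f_coef \<nu> 0\<close>.
  Cramer's rule gives \<open>k \<ge> 1\<close>; \<open>k = 0\<close> is the convention for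
  \<open>Dcol\<close>.\<close>

lemma Dcol_eq:
  assumes "k \<le> n"
  shows "Dcol \<nu> n (int k) = - (coeff (P n) k / coeff (P n) 0) * D \<nu> n"
proof (cases k)
  case 0
  then show ?thesis using coeff_P_0_nonzero[of n] by (simp add: Dcol_def)
next
  case (Suc j)
  let ?x = "Matrix.vec n (\<lambda>j. - (coeff (P n) (Suc j) / coeff (P n) 0))"
  have "f_mat \<nu> n *\<^sub>v ?x = Matrix.vec n (\<lambda>m. f_coef \<nu> 0 m)"
  proof (intro eq_vecI)
    fix m assume "m < dim_vec (Matrix.vec n (\<lambda>m. f_coef \<nu> 0 m))"
    then have m: "m < n" by simp
    have "lin mom (monom 1 (Suc m) * (\<Sum>j<n. monom (- (coeff (P n) (Suc j) / coeff (P n) 0)) j))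
        = - 1 / coeff (P n) 0 * lin mom (monom 1 (Suc m) * (\<Sum>j<n. monom (coeff (P n) (Suc j)) j))"
      by (simp add: lin_monom_mult_lessThan sum_divide_distrib sum_negf)
    then have "vec_index (f_mat \<nu> n *\<^sub>v ?x) m = c m * (- 1 / coeff (P n) 0 * (- coeff (P n) 0 * mom m))"
      by (simp only: f_mat_mult_vec[OF m] sum_coeff_P_mom[OF m])
    then show "vec_index (f_mat \<nu> n *\<^sub>v ?x) m = vec_index (Matrix.vec n (\<lambda>m. f_coef \<nu> 0 m)) m"
      using m coeff_P_0_nonzero[of n] by (simp add: f_coef_eq[OF nu])
  qed (simp add: f_mat_def)
  then have "Determinant.det (replace_col (f_mat \<nu> n) (Matrix.vec n (\<lambda>m. f_coef \<nu> 0 m)) j) = vec_index ?x j * D \<nu> n"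
    using cramer_lemma_mat[OF f_mat_carrier, of ?x n j \<nu>] assms Suc by (simp add: D_def)
  moreover have "Dcol \<nu> n (int k) = Determinant.det (replace_col (f_mat \<nu> n) (Matrix.vec n (\<lambda>m. f_coef \<nu> 0 m)) j)"
    using assms Suc by (simp add: Dcol_def nat_add_distrib)
  ultimately show ?thesis
    using assms Suc by simp
qed

text \<open>The prefactor and summands of \<open>S\<close> assemble to moments of order
  \<open>n + k\<close>. As \<open>Dcol\<close> is proportional to the coefficients of
  \<open>P n\<close>, the sum is a multiple of the pairing of \<open>P n\<close> with the
  \<open>n\<close>-th power, the reciprocal leading coefficient.\<close>

lemma S_eq: "S \<nu> n = - D \<nu> n / (coeff (P n) 0 * coeff (P n) n)"
proof -
  have "S \<nu> n = (\<Sum>k\<le>n. Dcol \<nu> n (int k) * mom (n + k))"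
    unfolding S_def rho_moment_0_eq[OF nu] sum_distrib_left by (simp only: mult_ac)
  also have "\<dots> = (\<Sum>k\<le>n. - (D \<nu> n / coeff (P n) 0) * (coeff (P n) k * mom (n + k)))"
    by (intro sum.cong) (simp_all add: Dcol_eq)
  also have "\<dots> = - (D \<nu> n / coeff (P n) 0) * lin mom (monom 1 n * P n)"
    by (simp add: lin_monom_mult degree_P sum_distrib_left)
  also have "\<dots> = - D \<nu> n / (coeff (P n) 0 * coeff (P n) n)"
    by (simp add: lin_mult_P degree_monom_eq)
  finally show ?thesis .
qed

text \<open>The leading coefficient cancels, leaving the square that fixes the constant term up to
  sign.\<close>

lemma Dcol_S: "Dcol \<nu> n (int n) * S \<nu> n = (D \<nu> n / coeff (P n) 0)\<^sup>2"
  using lead_P[of n] by (simp add: Dcol_eq S_eq power2_eq_square)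

section \<open>The three-term recurrence in terms of leading coefficients\<close>

text \<open>\<open>A (Suc n)\<close> and \<open>B n\<close> are chosen to cancel the coefficients of
  degrees \<open>n + 1\<close> and \<open>n\<close> in the defect \<open>q\<close>. Pairing the
  lower-degree defect with \<open>P (degree q)\<close> then gives zero.\<close>

lemma three_term_recurrence:
  fixes A B :: "nat \<Rightarrow> real"
  assumes A: "\<And>n. A (Suc n) = coeff (P n) n / coeff (P (Suc n)) (Suc n)"
    and B: "\<And>n. B n = (if n = 0 then 0 else coeff (P n) (n - 1) / coeff (P n) n) - coeff (P (Suc n)) n / coeff (P (Suc n)) (Suc n)"
  shows "monom 1 1 * P n = Polynomial.smult (A (Suc n)) (P (Suc n)) + Polynomial.smult (B n) (P n)
    + Polynomial.smult (A n) (if n = 0 then 0 else P (n - 1))"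
proof -
  define Q where "Q = (if n = 0 then 0 else P (n - 1))"
  define q where "q = monom 1 1 * P n - (Polynomial.smult (A (Suc n)) (P (Suc n)) + Polynomial.smult (B n) (P n) + Polynomial.smult (A n) Q)"
  have nz: "coeff (P n) n \<noteq> 0" "coeff (P (Suc n)) (Suc n) \<noteq> 0"
    using lead_P[of n] lead_P[of "Suc n"] by auto
  have Q: "coeff Q i = 0" if "n \<le> i" for i
    using that by (cases n) (auto simp: Q_def degree_P coeff_eq_0)
  have xP: "coeff (monom 1 (Suc 0) * p) i = (if i = 0 then 0 else coeff p (i - 1))" for p :: "real poly" and i
    by (auto simp: coeff_monom_mult)
  have Bn: "B n * coeff (P n) n = (if n = 0 then 0 else coeff (P n) (n - 1)) - A (Suc n) * coeff (P (Suc n)) n"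
    using nz by (simp add: A B field_simps)
  have q_coeff: "coeff q i = 0" if "n \<le> i" for i
  proof -
    consider "i = n" | "i = Suc n" | "Suc n < i" using \<open>n \<le> i\<close> by linarith
    then show ?thesis
    proof cases
      case 1
      then show ?thesis using Q by (simp add: q_def xP Bn)
    next
      case 2
      then show ?thesis using nz Q by (simp add: q_def xP A degree_P coeff_eq_0)
    next
      case 3
      then show ?thesis using Q by (simp add: q_def xP degree_P coeff_eq_0)
    qed
  qed
  have "q = 0"
  proof (cases "q = 0")
    case False
    then have d: "degree q < n"
      using q_coeff[of "degree q"] by (metis leading_coeff_0_iff not_le)
    let ?d = "degree q"
    \<comment> \<open>Multiplication by \<open>x\<close> is symmetric for the pairing; moved to
      \<open>P ?d\<close> it yields degree at most \<open>n\<close>, so only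
      \<open>?d = n - 1\<close> contributes, with exactly the value \<open>A n\<close>.\<close>
    have "lin mom (monom 1 1 * P n * P ?d) = lin mom ((monom 1 1 * P ?d) * P n)"
      by (simp add: mult_ac)
    also have "\<dots> = (if Suc ?d = n then coeff (P ?d) ?d / coeff (P n) n else 0)"
    proof -
      have "degree (monom 1 1 * P ?d) \<le> n"
        using d by (intro degree_le) (auto simp: xP degree_P coeff_eq_0)
      then show ?thesis
        using d by (auto simp: lin_mult_P xP degree_P coeff_eq_0)
    qed
    also have "\<dots> = A n * lin mom (Q * P ?d)"
      using d by (cases n) (auto simp: Q_def lin_P_P A)
    finally have "lin mom (q * P ?d) = 0"
      using d by (simp add: q_def ring_distribs lin_add lin_diff lin_smult lin_P_P)
    then show ?thesis by (rule eq_0_if_orthogonal)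
  qed
  then show ?thesis by (simp add: q_def Q_def)
qed

end

theorem theorem2:
  fixes \<nu> :: real and P :: "nat \<Rightarrow> real poly" and a :: "nat \<Rightarrow> nat \<Rightarrow> real"
    and A B :: "nat \<Rightarrow> real"
  assumes nu: "\<nu> > - 1 / 2"
    and P: "orthonormal_polys (\<lambda>x. (rho \<nu> x)\<^sup>2) P"
    and a: "\<And>n k. a n k = coeff (P n) k"
    and A: "\<And>n. A (n + 1) = (a n 0 * D \<nu> (n + 1) * Dcol \<nu> n (int n)) /
                             (a (n + 1) 0 * D \<nu> n * Dcol \<nu> (n + 1) (int (n + 1)))"
    and B: "\<And>n. B n = Dcol \<nu> n (int n - 1) / Dcol \<nu> n (int n)
                        - Dcol \<nu> (n + 1) (int n) / Dcol \<nu> (n + 1) (int (n + 1))"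
  shows "(\<forall>n. D \<nu> n \<noteq> 0 \<and> Dcol \<nu> n (int n) * S \<nu> n > 0) \<and>
         (\<forall>n. \<forall>k\<in>{1..n}. a n k = - a n 0 * (Dcol \<nu> n (int k) / D \<nu> n)) \<and>
         (\<forall>n. \<exists>s\<in>{1, - 1}.
            a n 0 = s * D \<nu> n * (Dcol \<nu> n (int n) * S \<nu> n) powr (- 1 / 2) \<and>
            - (s * D \<nu> n * (Dcol \<nu> n (int n) * S \<nu> n) powr (- 1 / 2))
              * (Dcol \<nu> n (int n) / D \<nu> n) > 0) \<and>
         (\<forall>n x. x * poly (P n) x =
            A (n + 1) * poly (P (n + 1)) x + B n * poly (P n) x
            + A n * (if n = 0 then 0 else poly (P (n - 1)) x))"
proof -
  note Dcol = Dcol_eq[OF nu P, folded a]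
  note D = D_nonzero[OF nu P]
  note a0 = coeff_P_0_nonzero[OF nu P, folded a]
  note an = lead_P[OF nu P, folded a]
  note DS = Dcol_S[OF nu P, folded a]
  have pos: "Dcol \<nu> n (int n) * S \<nu> n > 0" for n
    using D a0 by (simp add: DS)
  have coef: "a n k = - a n 0 * (Dcol \<nu> n (int k) / D \<nu> n)" if "k \<in> {1..n}" for n k
    using that D a0 by (simp add: Dcol)
  have sign: "\<exists>s\<in>{1, - 1}. a n 0 = s * D \<nu> n * (Dcol \<nu> n (int n) * S \<nu> n) powr (- 1 / 2) \<and>
            - (s * D \<nu> n * (Dcol \<nu> n (int n) * S \<nu> n) powr (- 1 / 2)) * (Dcol \<nu> n (int n) / D \<nu> n) > 0" for n
  proof -
    \<comment> \<open>The power of \<open>Dcol * S\<close> below is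
      \<open>\<bar>a n 0\<bar> / \<bar>D \<nu> n\<bar>\<close>, so this sign restores
      \<open>a n 0\<close>.\<close>
    define s where "s = sgn (a n 0 * D \<nu> n)"
    have "(Dcol \<nu> n (int n) * S \<nu> n) powr (- 1 / 2) = 1 / sqrt ((D \<nu> n / a n 0)\<^sup>2)"
      using D a0 unfolding DS by (simp add: powr_minus_divide powr_half_sqrt)
    also have "\<dots> = \<bar>a n 0\<bar> / \<bar>D \<nu> n\<bar>"
      by simp
    finally have r: "(Dcol \<nu> n (int n) * S \<nu> n) powr (- 1 / 2) = \<bar>a n 0\<bar> / \<bar>D \<nu> n\<bar>" .
    have eq: "a n 0 = s * D \<nu> n * (Dcol \<nu> n (int n) * S \<nu> n) powr (- 1 / 2)"
      unfolding r s_def sgn_mult using D[of n] a0[of n] by (auto simp: sgn_if abs_if)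
    \<comment> \<open>The right-hand side is the leading coefficient \<open>a n n\<close>, also at
      \<open>n = 0\<close>.\<close>
    have "0 < - a n 0 * (Dcol \<nu> n (int n) / D \<nu> n)"
      using an[of n] D a0 by (simp add: Dcol)
    with eq have "- (s * D \<nu> n * (Dcol \<nu> n (int n) * S \<nu> n) powr (- 1 / 2)) * (Dcol \<nu> n (int n) / D \<nu> n) > 0"
      by metis
    moreover have "s \<in> {1, - 1}"
      using D[of n] a0[of n] by (auto simp: s_def sgn_if)
    ultimately show ?thesis using eq by blast
  qed
  \<comment> \<open>The determinants and constant terms cancel by \<open>Dcol_eq\<close>, leaving
    the ratio of leading coefficients.\<close>
  have A': "A (Suc n) = coeff (P n) n / coeff (P (Suc n)) (Suc n)" for n
    using A[of n] D[of n] D[of "Suc n"] a0[of n] a0[of "Suc n"] Dcol[of n n] Dcol[of "Suc n" "Suc n"] an[of n] an[of "Suc n"]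
    by (simp add: a field_simps)
  have B': "B n = (if n = 0 then 0 else coeff (P n) (n - 1) / coeff (P n) n) - coeff (P (Suc n)) n / coeff (P (Suc n)) (Suc n)" for n
  proof -
    \<comment> \<open>At \<open>n = 0\<close> the index is \<open>- 1\<close>, where
      \<open>Dcol\<close> has its conventional value 0; otherwise it is the index of the subleading
      coefficient.\<close>
    have "Dcol \<nu> n (int n - 1) / Dcol \<nu> n (int n) = (if n = 0 then 0 else coeff (P n) (n - 1) / coeff (P n) n)"
    proof (cases n)
      case 0
      then show ?thesis by (simp add: Dcol_def)
    next
      case (Suc m)
      then have e: "int n - 1 = int m" by simp
      have 1: "Dcol \<nu> n (int m) = - (a n m / a n 0) * D \<nu> n"
        by (rule Dcol) (use Suc in simp)
      have 2: "Dcol \<nu> n (int n) = - (a n n / a n 0) * D \<nu> n"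
        by (rule Dcol) simp
      show ?thesis
        unfolding e 1 2 using Suc D[of n] a0[of n] an[of n] by (simp add: a)
    qed
    moreover have "Dcol \<nu> (n + 1) (int n) / Dcol \<nu> (n + 1) (int (n + 1)) = coeff (P (Suc n)) n / coeff (P (Suc n)) (Suc n)"
      using D[of "Suc n"] a0[of "Suc n"] an[of "Suc n"] Dcol[of n "Suc n"] Dcol[of "Suc n" "Suc n"]
      by (simp add: a)
    ultimately show ?thesis using B[of n] by simp
  qed
  have "x * poly (P n) x = A (n + 1) * poly (P (n + 1)) x + B n * poly (P n) x
      + A n * (if n = 0 then 0 else poly (P (n - 1)) x)" for n x
    using arg_cong[OF three_term_recurrence[OF nu P A' B', of n], of "\<lambda>p. poly p x"]
    by (simp add: poly_monom split: if_splits)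
  with D pos coef sign show ?thesis by blast
qed

end
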